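(* Let $\omega$ be a majorant and let $p\in[1,\infty]$. Consider the following two conditions. (C1) For every $\varphi\in\Lambda_{\omega,p}(\mathbb{T})$ which is continuous on $\mathbb{T}$, one has $P[\varphi]\in\Lambda_{\omega,p}(\overline{\mathbb{D}})$. (C2) There is a constant $M>0$ such that for all $\delta\in[0,\pi]$, $$\delta\int_\delta^\pi\frac{\omega(t)}{t^2}\,dt\le M\omega(\delta).$$ Then (C2) implies (C1) for every $p\in[1,\infty]$, and (C1) and (C2) are equivalent for $p=\infty$.
   Context: $\mathbb{D}$ is the open unit disk in $\mathbb{C}$ and $\mathbb{T}=\partial\mathbb{D}$. A majorant is a continuous increasing function $\omega:[0,\infty)\to[0,\infty)$ with $\omega(0)=0$ such that $\omega(t)/t$ is non-increasing for $t>0$. In (C2), at $\delta=0$ the left side is understood as $0$ (convention $0\cdot\infty=0$). For $p\in(0,\infty)$ put $\mathcal{L}_p[F](z_1,z_2)=\left(\int_0^{2\pi}|F(e^{i\eta}z_1)-F(e^{i\eta}z_2)|^p\,d\eta\right)^{1/p}$, and $\mathcal{L}_\infty[F](z_1,z_2)=|F(z_1)-F(z_2)|$. $\Lambda_{\omega,p}(\mathbb{T})$ consists of those $F\in L^p(\mathbb{T})$ for which there is $M>0$ with $\mathcal{L}_p[F](\xi_1,\xi_2)\le M\omega(|\xi_1-\xi_2|)$ for all $\xi_1,\xi_2\in\mathbb{T}$. $\Lambda_{\omega,p}(\overline{\mathbb{D}})$ is the class of Borel functions $F:\overline{\mathbb{D}}\to\mathbb{C}$ for which there is $M>0$ with $\mathcal{L}_p[F](z_1,z_2)\le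 M\omega(|z_1-z_2|)$ for all $z_1,z_2\in\overline{\mathbb{D}}$. $P[\varphi](z)=\frac1{2\pi}\int_0^{2\pi}\varphi(e^{i\tau})\frac{1-|z|^2}{|e^{i\tau}-z|^2}\,d\tau$ for $z\in\mathbb{D}$ is the Poisson integral; for continuous $\varphi$ it is extended to $\mathbb{T}$ by $P[\varphi]=\varphi$. *)

theory Defs
  imports "HOL-Analysis.Analysis"
begin

text \<open>
  Functions on \<open>[0,\<infinity>)\<close>, on the unit circle \<open>sphere 0 1\<close> and on the closed unit disc \<open>cball 0 1\<close>
  are represented by total functions; their values outside these sets are never used.
  ``Increasing'' is read in the weak sense, which admits more majorants than the strict one.
\<close>

definition majorant :: "(real \<Rightarrow> real) \<Rightarrow> bool" where
  "majorant \<omega> \<longleftrightarrow>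
     continuous_on {0..} \<omega> \<and> mono_on {0..} \<omega> \<and> (\<forall>t\<ge>0. 0 \<le> \<omega> t) \<and> \<omega> 0 = 0 \<and>
     antimono_on {0<..} (\<lambda>t. \<omega> t / t)"

text \<open>Real powers on \<open>[0,\<infinity>]\<close>, only used with an exponent \<open>a > 0\<close>.\<close>

definition ennreal_powr :: "ennreal \<Rightarrow> real \<Rightarrow> ennreal" where
  "ennreal_powr x a = (if x = \<infinity> then \<infinity> else ennreal (enn2real x powr a))"

text \<open>
  The \<open>p\<close>-mean difference takes values in \<open>[0,\<infinity>]\<close>, so that a divergent integral counts as \<open>\<infinity>\<close>
  and violates every finite upper bound.  The integral is with respect to Lebesgue measure since
  elements of \<open>L\<^sup>p\<close> of the circle need only be Lebesgue measurable.
\<close>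

definition Lp_diff :: "ennreal \<Rightarrow> (complex \<Rightarrow> complex) \<Rightarrow> complex \<Rightarrow> complex \<Rightarrow> ennreal" where
  "Lp_diff p F z1 z2 =
     (if p = \<infinity> then ennreal (cmod (F z1 - F z2))
      else ennreal_powr
             (\<integral>\<^sup>+\<eta>. ennreal (cmod (F (cis \<eta> * z1) - F (cis \<eta> * z2)) powr enn2real p)
                \<partial>lebesgue_on {0..2*pi})
             (1 / enn2real p))"

definition Lp_circle :: "ennreal \<Rightarrow> (complex \<Rightarrow> complex) set" where
  "Lp_circle p =
     {F. (\<lambda>\<eta>. F (cis \<eta>)) \<in> borel_measurable (lebesgue_on {0..2*pi}) \<and>
         (if p = \<infinity> then \<exists>C::real. AE \<eta> in lebesgue_on {0..2*pi}. cmod (F (cis \<eta>)) \<le> C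
          else (\<integral>\<^sup>+\<eta>. ennreal (cmod (F (cis \<eta>)) powr enn2real p) \<partial>lebesgue_on {0..2*pi}) < \<infinity>)}"

definition Lambda_circle :: "(real \<Rightarrow> real) \<Rightarrow> ennreal \<Rightarrow> (complex \<Rightarrow> complex) set" where
  "Lambda_circle \<omega> p =
     {F \<in> Lp_circle p.
        \<exists>M::real>0. \<forall>\<xi>1\<in>sphere 0 1. \<forall>\<xi>2\<in>sphere 0 1.
          Lp_diff p F \<xi>1 \<xi>2 \<le> ennreal (M * \<omega> (cmod (\<xi>1 - \<xi>2)))}"

definition Lambda_disc :: "(real \<Rightarrow> real) \<Rightarrow> ennreal \<Rightarrow> (complex \<Rightarrow> complex) set" where
  "Lambda_disc \<omega> p =
     {F \<in> borel_measurable (restrict_space borel (cball 0 1)).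
        \<exists>M::real>0. \<forall>z1\<in>cball 0 1. \<forall>z2\<in>cball 0 1.
          Lp_diff p F z1 z2 \<le> ennreal (M * \<omega> (cmod (z1 - z2)))}"

text \<open>The Poisson integral on the open disc, extended by \<open>\<phi>\<close> itself to the unit circle.\<close>

definition poisson_ext :: "(complex \<Rightarrow> complex) \<Rightarrow> complex \<Rightarrow> complex" where
  "poisson_ext \<phi> z =
     (if z \<in> ball 0 1
      then 1 / (2 * of_real pi) *
           (LINT \<tau>|lebesgue_on {0..2*pi}.
              \<phi> (cis \<tau>) * of_real ((1 - (cmod z)\<^sup>2) / (cmod (cis \<tau> - z))\<^sup>2))
      else \<phi> z)"

definition poisson_preserves_Lambda :: "(real \<Rightarrow> real) \<Rightarrow> ennreal \<Rightarrow> bool" where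
  "poisson_preserves_Lambda \<omega> p \<longleftrightarrow>
     (\<forall>\<phi>\<in>Lambda_circle \<omega> p. continuous_on (sphere 0 1) \<phi> \<longrightarrow> poisson_ext \<phi> \<in> Lambda_disc \<omega> p)"

text \<open>
  For a majorant and \<open>\<delta> > 0\<close> the integrand is continuous on the compact interval \<open>{\<delta>..pi}\<close>, so the
  integral is a genuine one.  For \<open>\<delta> = 0\<close> the left-hand side is \<open>0\<close> because the integral is a real
  number, which agrees with the convention \<open>0 \<cdot> \<infinity> = 0\<close>.
\<close>

definition integral_condition :: "(real \<Rightarrow> real) \<Rightarrow> bool" where
  "integral_condition \<omega> \<longleftrightarrow>
     (\<exists>M::real>0. \<forall>\<delta>\<in>{0..pi}. \<delta> * (LINT t|lebesgue_on {\<delta>..pi}. \<omega> t / t\<^sup>2) \<le> M * \<omega> \<delta>)"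

end

theory Submission
  imports Defs "HOL-Complex_Analysis.Cauchy_Integral_Formula"
begin

text \<open>
  Write \<open>F = P[\<phi>]\<close>.  Both implications compare the Poisson kernel at \<open>z = r \<xi>\<close>, with \<open>|\<xi>| = 1\<close> and
  \<open>d = 1 - r\<close>, with \<open>1 / |e\<^sup>i\<^sup>\<tau> - z|\<^sup>2\<close>, and everything turns on the single integral
  \<open>K(r) = \<integral> \<omega>(|e\<^sup>i\<^sup>\<tau> - 1|) / |e\<^sup>i\<^sup>\<tau> - r|\<^sup>2 d\<tau>\<close>.  The part \<open>|\<tau>| \<le> d\<close> of \<open>K(r)\<close> is at most of the order
  \<open>\<omega>(d) / d\<close>, and the part \<open>d \<le> |\<tau>| \<le> \<pi>\<close> is comparable to \<open>\<integral>\<^sub>d\<^sup>\<pi> \<omega>(t) / t\<^sup>2 dt\<close>.  So the integral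
  condition gives \<open>K(r) \<le> B \<omega>(d) / d\<close> (\<open>majorant_poisson_integral\<close>).

  From the integral condition to the Poisson integral.  Since the kernel has total mass \<open>2\<pi>\<close>, the
  constant \<open>\<phi>(e\<^sup>i\<^sup>\<eta> \<xi>)\<close> can be subtracted from the boundary function under the integral.  This writes both
  \<open>F(e\<^sup>i\<^sup>\<eta> z) - \<phi>(e\<^sup>i\<^sup>\<eta> \<xi>)\<close> and \<open>F(e\<^sup>i\<^sup>\<eta> z) - F(e\<^sup>i\<^sup>\<eta> z')\<close> as the mean over \<open>\<tau>\<close> of
  \<open>(\<phi>(e\<^sup>i\<^sup>\<eta> e\<^sup>i\<^sup>\<tau>) - \<phi>(e\<^sup>i\<^sup>\<eta> \<xi>)) k(\<tau>)\<close> for a kernel with \<open>|k(\<tau>)| \<le> c / |e\<^sup>i\<^sup>\<tau> - z|\<^sup>2\<close>.  Here \<open>c = 2 d\<close> in the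
  first case, and \<open>c = 4 |z - z'|\<close> in the second one provided that \<open>2 |z - z'| \<le> d\<close>.  Minkowski's integral
  inequality (\<open>mean_le_integral\<close>) moves the \<open>p\<close>-mean over \<open>\<eta>\<close> inside, where the hypothesis on \<open>\<phi>\<close> bounds it
  by a multiple of \<open>\<omega>(|e\<^sup>i\<^sup>\<tau> - \<xi>|)\<close>, and what remains is \<open>c K(r) \<le> c B \<omega>(d) / d\<close>.  This is a multiple of
  \<open>\<omega>(d)\<close> in the first case, and of \<open>\<omega>(|z - z'|)\<close> in the second one, because \<open>\<omega>(t) / t\<close> decreases.
  If \<open>2 |z - z'| > d\<close>, then both points are within \<open>3 |z - z'|\<close> of the circle, and one passes from \<open>z\<close> to \<open>z'\<close> through
  their radial projections.

  From the Poisson integral to the integral condition.  The function \<open>\<phi>(\<xi>) = \<omega>(|\<xi> - 1|)\<close> satisfies the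
  hypothesis with constant \<open>1\<close>, since a majorant is subadditive, and it vanishes at \<open>1\<close>.  Hence
  \<open>F(1 - \<delta>) \<le> M \<omega>(\<delta>)\<close>, while restricting the positive integral \<open>F(1 - \<delta>)\<close> to \<open>\<delta> \<le> \<tau> \<le> \<pi>\<close> bounds it below by
  a multiple of \<open>\<delta> \<integral>\<^sub>\<delta>\<^sup>\<pi> \<omega>(t) / t\<^sup>2 dt\<close>.
\<close>

section \<open>Integrals of continuous and of periodic functions\<close>

lemma nn_integral_eq_HK:
  fixes f :: "real \<Rightarrow> real"
  assumes "continuous_on {a..b} f" "\<And>x. x \<in> {a..b} \<Longrightarrow> 0 \<le> f x"
  shows "(\<integral>\<^sup>+x. ennreal (f x) \<partial>lebesgue_on {a..b}) = ennreal (integral {a..b} f)"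
proof -
  have i: "integrable (lebesgue_on {a..b}) f"
    by (rule continuous_imp_integrable_real[OF assms(1)])
  have "(\<integral>\<^sup>+x. ennreal (f x) \<partial>lebesgue_on {a..b}) = ennreal (integral\<^sup>L (lebesgue_on {a..b}) f)"
    using assms by (intro nn_integral_eq_integral i AE_I2) simp
  then show ?thesis
    by (simp add: lebesgue_integral_eq_integral[OF i])
qed

lemma LINT_eq_HK:
  fixes f :: "real \<Rightarrow> 'b::euclidean_space"
  assumes "continuous_on {a..b} f"
  shows "integral\<^sup>L (lebesgue_on {a..b}) f = integral {a..b} f"
  by (rule lebesgue_integral_eq_integral[OF continuous_imp_integrable_real[OF assms]]) simp

lemma integral_periodic_shift:
  fixes f :: "real \<Rightarrow> 'b::euclidean_space"
  assumes f: "continuous_on UNIV f" and per: "\<And>x. f (x + c) = f x" and a: "0 \<le> a" "a \<le> c"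
  shows "integral {0..c} (\<lambda>x. f (x + a)) = integral {0..c} f"
proof -
  have int: "f integrable_on {u..v}" for u v
    by (intro integrable_continuous_interval continuous_on_subset[OF f]) auto
  have "integral {0..c} (\<lambda>x. f (x + a)) = integral {a..c + a} f"
    using integral_shift_real_ivl[of a a "c + a" f] by simp
  also have "\<dots> = integral {a..c} f + integral {c..c + a} f"
    using a by (intro Henstock_Kurzweil_Integration.integral_combine[symmetric] int) auto
  also have "integral {c..c + a} f = integral {0..a} (\<lambda>x. f (x + c))"
    using integral_shift_real_ivl[of c c "c + a" f] by simp
  also have "\<dots> = integral {0..a} f"
    by (simp add: per)
  also have "integral {a..c} f + integral {0..a} f = integral {0..a} f + integral {a..c} f"
    by simp
  also have "\<dots> = integral {0..c} f"
    using a by (intro Henstock_Kurzweil_Integration.integral_combine int) auto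
  finally show ?thesis .
qed

lemma integral_even_periodic:
  fixes f :: "real \<Rightarrow> real"
  assumes f: "continuous_on UNIV f" and per: "\<And>x. f (x + 2 * c) = f x" and ev: "\<And>x. f (- x) = f x"
    and c: "0 \<le> c"
  shows "integral {0..2 * c} f = 2 * integral {0..c} f"
proof -
  have int: "f integrable_on {u..v}" for u v
    by (intro integrable_continuous_interval continuous_on_subset[OF f]) auto
  have "integral {c..2 * c} f = integral {-c..0} (\<lambda>x. f (x + 2 * c))"
    using integral_shift_real_ivl[of c "2 * c" "2 * c" f] by simp
  also have "\<dots> = integral {-c..-0} (\<lambda>x. f (- x))"
    by (simp add: per ev)
  also have "\<dots> = integral {0..c} f"
    by (rule Henstock_Kurzweil_Integration.integral_reflect_real)
  finally show ?thesis
    using Henstock_Kurzweil_Integration.integral_combine[of 0 c "2 * c" f] c int by auto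
qed

section \<open>Jensen's inequality for powers\<close>

text \<open>
  The tangent at \<open>m\<close> lies below the convex function \<open>x\<^sup>p\<close>.  After division by \<open>m\<^sup>p\<close> this is
  Young's inequality for \<open>x / m\<close> and \<open>1\<close>.
\<close>

lemma powr_ge_tangent:
  fixes m x p :: real
  assumes "m > 0" "x \<ge> 0" "p \<ge> 1"
  shows "m powr p + p * m powr (p - 1) * (x - m) \<le> x powr p"
proof -
  define y where "y = x / m"
  have y: "y \<ge> 0" "x = m * y"
    using assms by (auto simp: y_def)
  have "p * y \<le> y powr p + (p - 1)"
  proof (cases "y = 0")
    case False
    then have "(y powr p) powr (1/p) * 1 powr (1 - 1/p) \<le> (1/p) * y powr p + (1 - 1/p) * 1"
      using y assms by (intro Youngs_inequality_0) auto
    then have "y \<le> (1/p) * y powr p + (1 - 1/p)"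
      using y assms by (simp add: powr_powr)
    then have "p * y \<le> p * ((1/p) * y powr p + (1 - 1/p))"
      using assms by (intro mult_left_mono) auto
    also have "\<dots> = y powr p + (p - 1)"
      using assms by (simp add: algebra_simps)
    finally show ?thesis .
  qed (use assms in auto)
  then have "m powr p * (1 + p * (y - 1)) \<le> m powr p * y powr p"
    by (intro mult_left_mono) (auto simp: algebra_simps)
  moreover have "m powr p = m powr (p - 1) * m"
    using assms by (simp add: powr_diff)
  ultimately show ?thesis
    using y assms by (simp add: powr_mult algebra_simps)
qed

text \<open>
  Jensen's inequality for \<open>x\<^sup>p\<close> and the weight \<open>\<rho>\<close>, multiplied by a power of the total weight: it follows by
  integrating the tangent inequality at the weighted mean \<open>m\<close> of \<open>x\<close>.
\<close>

lemma jensen_powr: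
  fixes \<rho> x :: "real \<Rightarrow> real"
  assumes "a < b" "p \<ge> 1"
    and c\<rho>: "continuous_on {a..b} \<rho>" and cx: "continuous_on {a..b} x"
    and \<rho>: "\<And>t. t \<in> {a..b} \<Longrightarrow> \<rho> t > 0" and x: "\<And>t. t \<in> {a..b} \<Longrightarrow> x t \<ge> 0"
  shows "integral {a..b} (\<lambda>t. \<rho> t * x t) powr p
         \<le> integral {a..b} \<rho> powr (p - 1) * integral {a..b} (\<lambda>t. \<rho> t * x t powr p)"
proof -
  define A where "A = integral {a..b} \<rho>"
  define B where "B = integral {a..b} (\<lambda>t. \<rho> t * x t)"
  define m where "m = B / A"
  have "A \<ge> 0"
    unfolding A_def using c\<rho> \<rho> by (intro integral_nonneg integrable_continuous_interval) (auto intro: less_imp_le)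
  moreover have "A \<noteq> 0"
    unfolding A_def using integral_eq_0_iff[OF c\<rho> \<open>a < b\<close>] \<rho> \<open>a < b\<close>
    by (metis atLeastAtMost_iff less_irrefl less_imp_le order_refl)
  ultimately have A: "A > 0" by simp
  have cxp: "continuous_on {a..b} (\<lambda>t. x t powr p)"
    using assms by (intro continuous_on_powr' cx continuous_on_const) auto
  have B0: "B \<ge> 0"
    unfolding B_def using \<rho> x
    by (intro integral_nonneg integrable_continuous_interval continuous_intros c\<rho> cx) (auto simp: less_imp_le)
  have I0: "integral {a..b} (\<lambda>t. \<rho> t * x t powr p) \<ge> 0"
    using \<rho> by (intro integral_nonneg integrable_continuous_interval continuous_intros c\<rho> cxp) (auto simp: less_imp_le)
  show ?thesis
  proof (cases "B = 0")
    case True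
    then show ?thesis using I0 assms unfolding B_def by auto
  next
    case False
    with A B0 have m: "m > 0" by (simp add: m_def)
    have "((\<lambda>t. (m powr p - p * m powr (p - 1) * m) * \<rho> t + (p * m powr (p - 1)) * (\<rho> t * x t))
            has_integral (m powr p - p * m powr (p - 1) * m) * A + (p * m powr (p - 1)) * B) {a..b}"
      unfolding A_def B_def
      by (intro has_integral_add has_integral_mult_right integrable_integral integrable_continuous_interval
           continuous_intros c\<rho> cx)
    moreover have "m * A = B"
      using A by (simp add: m_def)
    then have "(m powr p - p * m powr (p - 1) * m) * A + (p * m powr (p - 1)) * B = A * m powr p"
      by (simp add: algebra_simps)
    ultimately have "A * m powr p = integral {a..b} (\<lambda>t. (m powr p - p * m powr (p - 1) * m) * \<rho> t
              + (p * m powr (p - 1)) * (\<rho> t * x t))"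
      by (metis (no_types, lifting) integral_unique)
    also have "\<dots> = integral {a..b} (\<lambda>t. \<rho> t * (m powr p + p * m powr (p - 1) * (x t - m)))"
      by (simp add: algebra_simps)
    also have "\<dots> \<le> integral {a..b} (\<lambda>t. \<rho> t * x t powr p)"
      using \<rho> x powr_ge_tangent[OF m _ \<open>p \<ge> 1\<close>]
      by (intro integral_le integrable_continuous_interval continuous_intros c\<rho> cx cxp mult_left_mono)
         (auto simp: less_imp_le)
    finally have "A powr (p - 1) * (A * m powr p) \<le> A powr (p - 1) * integral {a..b} (\<lambda>t. \<rho> t * x t powr p)"
      by (intro mult_left_mono) auto
    moreover have "A powr (p - 1) * (A * m powr p) = B powr p"
    proof -
      have "A powr (p - 1) * A = A powr p"
        using A by (simp add: powr_diff)
      then have "A powr (p - 1) * (A * m powr p) = (A * m) powr p"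
        using A m by (simp add: powr_mult mult.assoc[symmetric])
      then show ?thesis using A by (simp add: m_def)
    qed
    ultimately show ?thesis
      by (simp add: A_def B_def)
  qed
qed

section \<open>Means over rotations and Minkowski's integral inequality\<close>

text \<open>
  The bound that the \<open>p\<close>-mean of \<open>g\<close> over a period is at most \<open>c\<close>, with the \<open>p\<close>-th root cleared.  For \<open>p = \<infinity>\<close> only
  the value at \<open>0\<close> counts: then \<open>Lp_diff\<close> compares \<open>F\<close> at the two given points, not at their rotations.
\<close>

definition mean_le :: "ennreal \<Rightarrow> (real \<Rightarrow> complex) \<Rightarrow> real \<Rightarrow> bool" where
  "mean_le p g c \<longleftrightarrow>
     (if p = \<infinity> then cmod (g 0) \<le> c
      else (\<integral>\<^sup>+\<eta>. ennreal (cmod (g \<eta>) powr enn2real p) \<partial>lebesgue_on {0..2*pi}) \<le> ennreal (c powr enn2real p))"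

lemma enn2real_ge_1: "1 \<le> p \<Longrightarrow> p \<noteq> \<infinity> \<Longrightarrow> 1 \<le> enn2real p"
  using enn2real_mono[of 1 p] by (simp add: top.not_eq_extremum)

lemma Lp_diff_le_iff:
  assumes "1 \<le> p" "0 \<le> c"
  shows "Lp_diff p F z1 z2 \<le> ennreal c \<longleftrightarrow> mean_le p (\<lambda>\<eta>. F (cis \<eta> * z1) - F (cis \<eta> * z2)) c"
proof (cases "p = \<infinity>")
  case True
  then show ?thesis using assms by (simp add: Lp_diff_def mean_le_def)
next
  case False
  define q where "q = enn2real p"
  have q: "q \<ge> 1" unfolding q_def using False assms by (intro enn2real_ge_1)
  define X where "X = (\<integral>\<^sup>+\<eta>. ennreal (cmod (F (cis \<eta> * z1) - F (cis \<eta> * z2)) powr q) \<partial>lebesgue_on {0..2*pi})"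
  have "ennreal_powr X (1/q) \<le> ennreal c \<longleftrightarrow> X \<le> ennreal (c powr q)"
  proof (cases X)
    case (real x)
    have "x powr (1/q) \<le> c \<longleftrightarrow> (x powr (1/q)) powr q \<le> c powr q"
      using q assms powr_mono2[of q "x powr (1/q)" c] powr_less_mono2[of q c "x powr (1/q)"]
      by fastforce
    also have "\<dots> \<longleftrightarrow> x \<le> c powr q"
      using q real by (simp add: powr_powr)
    finally show ?thesis
      using real assms by (simp add: ennreal_powr_def)
  next
    case top
    then show ?thesis by (simp add: ennreal_powr_def top_unique)
  qed
  then show ?thesis
    using False by (simp add: Lp_diff_def mean_le_def X_def q_def)
qed

lemma mean_le_cong:
  assumes "\<And>\<eta>. cmod (g \<eta>) = cmod (h \<eta>)"
  shows "mean_le p g c = mean_le p h c"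
  by (simp add: mean_le_def assms)

lemma mean_le_mono:
  assumes "mean_le p g c" "0 \<le> c" "c \<le> d" "1 \<le> p" "\<And>\<eta>. cmod (h \<eta>) \<le> cmod (g \<eta>)"
  shows "mean_le p h d"
proof (cases "p = \<infinity>")
  case True
  then show ?thesis using assms(1,3) assms(5)[of 0] by (simp add: mean_le_def)
next
  case False
  have q: "enn2real p \<ge> 1" using False assms by (intro enn2real_ge_1)
  have "(\<integral>\<^sup>+\<eta>. ennreal (cmod (h \<eta>) powr enn2real p) \<partial>lebesgue_on {0..2*pi})
      \<le> (\<integral>\<^sup>+\<eta>. ennreal (cmod (g \<eta>) powr enn2real p) \<partial>lebesgue_on {0..2*pi})"
    using q assms(5) by (intro nn_integral_mono ennreal_leI powr_mono2) auto
  also have "\<dots> \<le> ennreal (c powr enn2real p)"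
    using assms(1) False by (simp add: mean_le_def)
  also have "\<dots> \<le> ennreal (d powr enn2real p)"
    using q assms by (intro ennreal_leI powr_mono2) auto
  finally show ?thesis using False by (simp add: mean_le_def)
qed

lemma borel_measurable_lebesgue_on_continuous:
  fixes f :: "real \<Rightarrow> 'b::topological_space"
  assumes "continuous_on UNIV f"
  shows "f \<in> borel_measurable (lebesgue_on S)"
  using borel_measurable_continuous_onI[OF assms]
  by (intro measurable_restrict_space1 measurable_completion) simp

text \<open>
  A triangle inequality with a crude constant, from \<open>|a + b| \<le> 2 max(|a|, |b|)\<close>; the value of the constant only
  enters the final Lipschitz constant.
\<close>

lemma mean_le_add:
  assumes "continuous_on UNIV g" "continuous_on UNIV h"
    and "mean_le p g c" "mean_le p h c" "0 \<le> c" "1 \<le> p"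
  shows "mean_le p (\<lambda>\<eta>. g \<eta> + h \<eta>) (4 * c)"
proof (cases "p = \<infinity>")
  case True
  then show ?thesis using assms norm_triangle_ineq[of "g 0" "h 0"] by (simp add: mean_le_def)
next
  case False
  define q where "q = enn2real p"
  have q: "q \<ge> 1" unfolding q_def using False assms by (intro enn2real_ge_1)
  let ?L = "lebesgue_on {0..2*pi}"
  have meas: "(\<lambda>\<eta>. ennreal (cmod (f \<eta>) powr q)) \<in> borel_measurable ?L" if "continuous_on UNIV f" for f
    using borel_measurable_lebesgue_on_continuous[OF that] by measurable
  have "cmod (g \<eta> + h \<eta>) powr q \<le> 2 powr q * (cmod (g \<eta>) powr q + cmod (h \<eta>) powr q)" for \<eta>
  proof -
    have "cmod (g \<eta> + h \<eta>) powr q \<le> (2 * max (cmod (g \<eta>)) (cmod (h \<eta>))) powr q"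
      using q norm_triangle_ineq[of "g \<eta>" "h \<eta>"] by (intro powr_mono2) auto
    also have "\<dots> = 2 powr q * max (cmod (g \<eta>)) (cmod (h \<eta>)) powr q"
      by (simp add: powr_mult)
    also have "\<dots> \<le> 2 powr q * (cmod (g \<eta>) powr q + cmod (h \<eta>) powr q)"
      by (intro mult_left_mono) (auto simp: max_def)
    finally show ?thesis .
  qed
  then have "(\<integral>\<^sup>+\<eta>. ennreal (cmod (g \<eta> + h \<eta>) powr q) \<partial>?L)
      \<le> (\<integral>\<^sup>+\<eta>. ennreal (2 powr q) * (ennreal (cmod (g \<eta>) powr q) + ennreal (cmod (h \<eta>) powr q)) \<partial>?L)"
    by (intro nn_integral_mono) (simp flip: ennreal_plus ennreal_mult)
  also have "\<dots> = ennreal (2 powr q) * ((\<integral>\<^sup>+\<eta>. ennreal (cmod (g \<eta>) powr q) \<partial>?L) + (\<integral>\<^sup>+\<eta>. ennreal (cmod (h \<eta>) powr q) \<partial>?L))"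
    using meas assms(1,2) by (subst nn_integral_cmult) (auto simp: nn_integral_add)
  also have "\<dots> \<le> ennreal (2 powr q) * (ennreal (c powr q) + ennreal (c powr q))"
    using assms(3,4) False by (intro mult_left_mono add_mono) (auto simp: mean_le_def q_def)
  also have "\<dots> = ennreal (2 powr q * (2 * c powr q))"
    by (simp flip: ennreal_plus ennreal_mult)
  also have "\<dots> \<le> ennreal ((4 * c) powr q)"
  proof (intro ennreal_leI)
    have "(4 * c) powr q = 2 powr q * (2 powr q * c powr q)"
      using assms powr_mult[of 2 "2 * c" q] powr_mult[of 2 c q] by simp
    moreover have "2 powr 1 \<le> (2::real) powr q"
      using q by (intro powr_mono) auto
    ultimately show "2 powr q * (2 * c powr q) \<le> (4 * c) powr q"
      by (simp add: mult_right_mono)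
  qed
  finally show ?thesis using False by (simp add: mean_le_def q_def)
qed

text \<open>
  Minkowski's integral inequality for \<open>|g| \<le> \<integral> \<kappa>(\<tau>) |G(\<tau>, \<cdot>)| d\<tau>\<close> when the means of the sections
  \<open>G(\<tau>, \<cdot>)\<close> have known positive bounds \<open>w(\<tau>)\<close>.  These bounds make duality unnecessary: Jensen's inequality
  for the weight \<open>\<kappa> w\<close> and the function \<open>|G| / w\<close> gives \<open>|g|\<^sup>p \<le> A\<^sup>p\<^sup>-\<^sup>1 \<integral> \<kappa> w (|G| / w)\<^sup>p d\<tau>\<close> with
  \<open>A = \<integral> \<kappa> w d\<tau>\<close>, and integrating over \<open>\<eta>\<close> first leaves at most \<open>A\<^sup>p\<^sup>-\<^sup>1 A\<close>.
\<close>

lemma mean_le_integral_pos: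
  fixes G :: "real \<Rightarrow> real \<Rightarrow> complex"
  assumes p: "1 \<le> p"
    and G: "continuous_on UNIV (\<lambda>(\<tau>, \<eta>). G \<tau> \<eta>)"
    and \<kappa>: "continuous_on UNIV \<kappa>" "\<And>\<tau>. \<kappa> \<tau> > 0"
    and w: "continuous_on UNIV w" "\<And>\<tau>. w \<tau> > 0"
    and m: "\<And>\<tau>. mean_le p (G \<tau>) (w \<tau>)"
    and g: "\<And>\<eta>. cmod (g \<eta>) \<le> integral {0..2*pi} (\<lambda>\<tau>. \<kappa> \<tau> * cmod (G \<tau> \<eta>))"
  shows "mean_le p g (integral {0..2*pi} (\<lambda>\<tau>. \<kappa> \<tau> * w \<tau>))"
proof -
  have contG: "continuous_on S (\<lambda>\<tau>. G \<tau> \<eta>)" for \<eta> S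
    by (rule continuous_on_subset[OF continuous_on_compose2[OF G, of UNIV "\<lambda>\<tau>. (\<tau>, \<eta>)", simplified]])
       (auto intro!: continuous_intros)
  have c\<kappa>: "continuous_on S \<kappa>" and cw: "continuous_on S w" for S
    using \<kappa> w continuous_on_subset by blast+
  show ?thesis
  proof (cases "p = \<infinity>")
    case True
    have "cmod (g 0) \<le> integral {0..2*pi} (\<lambda>\<tau>. \<kappa> \<tau> * cmod (G \<tau> 0))"
      by (rule g)
    also have "\<dots> \<le> integral {0..2*pi} (\<lambda>\<tau>. \<kappa> \<tau> * w \<tau>)"
      using m True \<kappa>
      by (intro integral_le integrable_continuous_interval continuous_intros c\<kappa> cw contG mult_left_mono)
         (auto simp: mean_le_def less_imp_le)
    finally show ?thesis using True by (simp add: mean_le_def)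
  next
    case False
    define q where "q = enn2real p"
    have q: "q \<ge> 1" unfolding q_def using False p by (intro enn2real_ge_1)
    let ?L = "lebesgue_on {0..2*pi}"
    define A where "A = integral {0..2*pi} (\<lambda>\<tau>. \<kappa> \<tau> * w \<tau>)"
    have A0: "A \<ge> 0"
      unfolding A_def using \<kappa> w
      by (intro integral_nonneg integrable_continuous_interval continuous_intros c\<kappa> cw) (auto simp: less_imp_le)
    \<comment> \<open>\<open>b |G|\<^sup>q\<close> is the integrand \<open>\<kappa> w (|G| / w)\<^sup>q\<close>, with the dependence on \<open>\<eta>\<close> isolated\<close>
    define b where "b \<tau> = \<kappa> \<tau> * w \<tau> * w \<tau> powr (- q)" for \<tau>
    have b0: "b \<tau> \<ge> 0" for \<tau>
      using \<kappa>(2)[of \<tau>] w(2)[of \<tau>] by (simp add: b_def)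
    have wne: "w \<tau> \<noteq> 0" for \<tau> using w(2)[of \<tau>] by simp
    have cb: "continuous_on S b" for S
      unfolding b_def by (intro continuous_intros c\<kappa> cw) (use wne in auto)
    have cGq: "continuous_on S (\<lambda>\<tau>. cmod (G \<tau> \<eta>) powr q)" for S \<eta>
      using q by (intro continuous_on_powr' continuous_intros contG) auto
    have pt: "cmod (g \<eta>) powr q \<le> A powr (q - 1) * integral {0..2*pi} (\<lambda>\<tau>. b \<tau> * cmod (G \<tau> \<eta>) powr q)" for \<eta>
    proof -
      have "cmod (g \<eta>) powr q \<le> integral {0..2*pi} (\<lambda>\<tau>. \<kappa> \<tau> * cmod (G \<tau> \<eta>)) powr q"
        using q g by (intro powr_mono2) auto
      also have "(\<lambda>\<tau>. \<kappa> \<tau> * cmod (G \<tau> \<eta>)) = (\<lambda>\<tau>. (\<kappa> \<tau> * w \<tau>) * (cmod (G \<tau> \<eta>) / w \<tau>))"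
        using w(2) by (simp add: fun_eq_iff wne)
      also have "integral {0..2*pi} (\<lambda>\<tau>. (\<kappa> \<tau> * w \<tau>) * (cmod (G \<tau> \<eta>) / w \<tau>)) powr q
          \<le> A powr (q - 1) * integral {0..2*pi} (\<lambda>\<tau>. (\<kappa> \<tau> * w \<tau>) * (cmod (G \<tau> \<eta>) / w \<tau>) powr q)"
        unfolding A_def using q \<kappa> w
        by (intro jensen_powr continuous_intros c\<kappa> cw contG) (auto simp: less_imp_le wne)
      also have "(\<lambda>\<tau>. (\<kappa> \<tau> * w \<tau>) * (cmod (G \<tau> \<eta>) / w \<tau>) powr q) = (\<lambda>\<tau>. b \<tau> * cmod (G \<tau> \<eta>) powr q)"
        using w(2) by (simp add: fun_eq_iff b_def powr_divide powr_minus field_simps less_imp_le)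
      finally show ?thesis .
    qed
    interpret L: finite_measure ?L
      by (rule finite_measure_lebesgue_on) simp
    interpret P: pair_sigma_finite ?L ?L
      by unfold_locales
    have meas2: "(\<lambda>(\<tau>, \<eta>). ennreal (b \<tau> * cmod (G \<tau> \<eta>) powr q)) \<in> borel_measurable (?L \<Otimes>\<^sub>M ?L)"
    proof -
      have "continuous_on UNIV (\<lambda>x. b (fst x) * cmod (G (fst x) (snd x)) powr q)"
        using q G cb[of UNIV]
        by (intro continuous_on_mult continuous_on_powr' continuous_on_const continuous_on_norm
             continuous_on_compose2[OF cb[of UNIV] continuous_on_fst[OF continuous_on_id]])
           (auto simp: case_prod_beta)
      then have *: "(\<lambda>x. b (fst x) * cmod (G (fst x) (snd x)) powr q) \<in> borel_measurable (borel \<Otimes>\<^sub>M borel)"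
        unfolding borel_prod by (rule borel_measurable_continuous_onI)
      have id: "(\<lambda>x. x) \<in> measurable ?L borel"
        by (rule borel_measurable_lebesgue_on_continuous) (rule continuous_on_id)
      have "(\<lambda>x. (fst x, snd x)) \<in> measurable (?L \<Otimes>\<^sub>M ?L) (borel \<Otimes>\<^sub>M borel)"
        using measurable_compose[OF measurable_fst id] measurable_compose[OF measurable_snd id] by measurable
      from measurable_compose[OF this *] show ?thesis
        by (simp add: case_prod_beta)
    qed
    have "(\<integral>\<^sup>+\<eta>. ennreal (cmod (g \<eta>) powr q) \<partial>?L)
        \<le> (\<integral>\<^sup>+\<eta>. ennreal (A powr (q - 1)) * (\<integral>\<^sup>+\<tau>. ennreal (b \<tau> * cmod (G \<tau> \<eta>) powr q) \<partial>?L) \<partial>?L)"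
    proof (intro nn_integral_mono)
      fix \<eta>
      have "(\<integral>\<^sup>+\<tau>. ennreal (b \<tau> * cmod (G \<tau> \<eta>) powr q) \<partial>?L) = ennreal (integral {0..2*pi} (\<lambda>\<tau>. b \<tau> * cmod (G \<tau> \<eta>) powr q))"
        using b0 by (intro nn_integral_eq_HK continuous_on_mult cb cGq) auto
      then show "ennreal (cmod (g \<eta>) powr q) \<le> ennreal (A powr (q - 1)) * (\<integral>\<^sup>+\<tau>. ennreal (b \<tau> * cmod (G \<tau> \<eta>) powr q) \<partial>?L)"
        using pt by (simp add: ennreal_leI flip: ennreal_mult')
    qed
    also have "\<dots> = ennreal (A powr (q - 1)) * (\<integral>\<^sup>+\<eta>. (\<integral>\<^sup>+\<tau>. ennreal (b \<tau> * cmod (G \<tau> \<eta>) powr q) \<partial>?L) \<partial>?L)"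
    proof (rule nn_integral_cmult)
      show "(\<lambda>\<eta>. \<integral>\<^sup>+\<tau>. ennreal (b \<tau> * cmod (G \<tau> \<eta>) powr q) \<partial>?L) \<in> borel_measurable ?L"
        using measurable_pair_swap[OF meas2]
        by (intro L.borel_measurable_nn_integral) (simp add: case_prod_beta)
    qed
    also have "(\<integral>\<^sup>+\<eta>. (\<integral>\<^sup>+\<tau>. ennreal (b \<tau> * cmod (G \<tau> \<eta>) powr q) \<partial>?L) \<partial>?L)
             = (\<integral>\<^sup>+\<tau>. (\<integral>\<^sup>+\<eta>. ennreal (b \<tau> * cmod (G \<tau> \<eta>) powr q) \<partial>?L) \<partial>?L)"
      using meas2 by (rule P.Fubini')
    also have "\<dots> \<le> (\<integral>\<^sup>+\<tau>. ennreal (\<kappa> \<tau> * w \<tau>) \<partial>?L)"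
    proof (intro nn_integral_mono)
      fix \<tau>
      have cG2: "continuous_on UNIV (G \<tau>)"
        by (rule continuous_on_compose2[OF G, of UNIV "\<lambda>\<eta>. (\<tau>, \<eta>)", simplified])
           (auto intro!: continuous_intros)
      have "(\<integral>\<^sup>+\<eta>. ennreal (b \<tau> * cmod (G \<tau> \<eta>) powr q) \<partial>?L) = (\<integral>\<^sup>+\<eta>. ennreal (b \<tau>) * ennreal (cmod (G \<tau> \<eta>) powr q) \<partial>?L)"
        using b0 by (simp add: ennreal_mult)
      also have "\<dots> = ennreal (b \<tau>) * (\<integral>\<^sup>+\<eta>. ennreal (cmod (G \<tau> \<eta>) powr q) \<partial>?L)"
        using borel_measurable_lebesgue_on_continuous[OF cG2] by (intro nn_integral_cmult) measurable
      also have "\<dots> \<le> ennreal (b \<tau>) * ennreal (w \<tau> powr q)"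
        using m[of \<tau>] False by (intro mult_left_mono) (auto simp: mean_le_def q_def)
      also have "\<dots> = ennreal (\<kappa> \<tau> * w \<tau>)"
      proof -
        have "b \<tau> * w \<tau> powr q = \<kappa> \<tau> * w \<tau>"
          using wne[of \<tau>] by (simp add: b_def powr_minus field_simps)
        then show ?thesis using b0[of \<tau>] by (simp flip: ennreal_mult)
      qed
      finally show "(\<integral>\<^sup>+\<eta>. ennreal (b \<tau> * cmod (G \<tau> \<eta>) powr q) \<partial>?L) \<le> ennreal (\<kappa> \<tau> * w \<tau>)" .
    qed
    also have "\<dots> = ennreal A"
      unfolding A_def using \<kappa> w
      by (intro nn_integral_eq_HK continuous_intros c\<kappa> cw) (auto simp: less_imp_le)
    also have "ennreal (A powr (q - 1)) * ennreal A = ennreal (A powr q)"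
      using A0 by (cases "A = 0") (auto simp: powr_diff simp flip: ennreal_mult)
    finally show ?thesis
      using False by (simp add: mean_le_def q_def A_def mult_left_mono)
  qed
qed

text \<open>
  In the application \<open>w\<close> vanishes at one point (and identically for the zero majorant), so the positive
  case is applied to \<open>w + \<epsilon>\<close>.
\<close>

lemma mean_le_integral:
  fixes G :: "real \<Rightarrow> real \<Rightarrow> complex"
  assumes p: "1 \<le> p"
    and G: "continuous_on UNIV (\<lambda>(\<tau>, \<eta>). G \<tau> \<eta>)"
    and \<kappa>: "continuous_on UNIV \<kappa>" "\<And>\<tau>. \<kappa> \<tau> > 0"
    and w: "continuous_on UNIV w" "\<And>\<tau>. w \<tau> \<ge> 0"
    and m: "\<And>\<tau>. mean_le p (G \<tau>) (w \<tau>)"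
    and g: "\<And>\<eta>. cmod (g \<eta>) \<le> integral {0..2*pi} (\<lambda>\<tau>. \<kappa> \<tau> * cmod (G \<tau> \<eta>))"
  shows "mean_le p g (integral {0..2*pi} (\<lambda>\<tau>. \<kappa> \<tau> * w \<tau>))"
proof -
  have c\<kappa>: "continuous_on S \<kappa>" and cw: "continuous_on S w" for S
    using \<kappa> w continuous_on_subset by blast+
  define A where "A = integral {0..2*pi} (\<lambda>\<tau>. \<kappa> \<tau> * w \<tau>)"
  define B where "B = integral {0..2*pi} \<kappa>"
  have A0: "A \<ge> 0"
    unfolding A_def using \<kappa> w
    by (intro integral_nonneg integrable_continuous_interval continuous_intros c\<kappa> cw) (auto simp: less_imp_le)
  have B0: "B \<ge> 0"
    unfolding B_def using \<kappa>
    by (intro integral_nonneg integrable_continuous_interval c\<kappa>) (auto simp: less_imp_le)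
  have eps: "mean_le p g (A + \<epsilon> * B)" if "\<epsilon> > 0" for \<epsilon>
  proof -
    have "mean_le p g (integral {0..2*pi} (\<lambda>\<tau>. \<kappa> \<tau> * (w \<tau> + \<epsilon>)))"
    proof (rule mean_le_integral_pos[OF p G \<kappa> _ _ _ g])
      show "mean_le p (G \<tau>) (w \<tau> + \<epsilon>)" for \<tau>
        by (rule mean_le_mono[OF m]) (use w p that in auto)
      show "w \<tau> + \<epsilon> > 0" for \<tau> using w(2)[of \<tau>] that by simp
    qed (auto intro!: continuous_intros cw)
    also have "integral {0..2*pi} (\<lambda>\<tau>. \<kappa> \<tau> * (w \<tau> + \<epsilon>)) = A + \<epsilon> * B"
    proof -
      have "((\<lambda>\<tau>. \<kappa> \<tau> * w \<tau> + \<epsilon> * \<kappa> \<tau>) has_integral A + \<epsilon> * B) {0..2*pi}"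
        unfolding A_def B_def
        by (intro has_integral_add has_integral_mult_right integrable_integral integrable_continuous_interval
           continuous_intros c\<kappa> cw)
      then show ?thesis by (simp add: integral_unique algebra_simps)
    qed
    finally show ?thesis .
  qed
  have lim: "((\<lambda>\<epsilon>. A + \<epsilon> * B) \<longlongrightarrow> A) (at_right 0)"
    by (auto intro!: tendsto_eq_intros)
  have ev: "eventually (\<lambda>\<epsilon>. mean_le p g (A + \<epsilon> * B)) (at_right 0)"
    by (rule eventually_mono[OF eventually_at_right_less eps])
  have "mean_le p g A"
  proof (cases "p = \<infinity>")
    case True
    then show ?thesis
      using tendsto_lowerbound[OF lim, of "cmod (g 0)"] ev by (simp add: mean_le_def)
  next
    case False
    define q where "q = enn2real p"
    have q: "q \<ge> 1" unfolding q_def using False p by (intro enn2real_ge_1)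
    have "((\<lambda>\<epsilon>. ennreal ((A + \<epsilon> * B) powr q)) \<longlongrightarrow> ennreal (A powr q)) (at_right 0)"
    proof (intro tendsto_ennrealI tendsto_powr2[OF lim tendsto_const])
      show "eventually (\<lambda>\<epsilon>. 0 \<le> A + \<epsilon> * B) (at_right 0)"
        using A0 B0 by (intro eventually_mono[OF eventually_at_right_less[of 0]]) auto
    qed (use q in auto)
    then show ?thesis
      using tendsto_lowerbound[of "\<lambda>\<epsilon>. ennreal ((A + \<epsilon> * B) powr q)" _ "at_right 0"] ev False
      by (simp add: mean_le_def q_def)
  qed
  then show ?thesis by (simp add: A_def)
qed

section \<open>The Poisson kernel and the Poisson integral\<close>

definition poisson_kernel :: "complex \<Rightarrow> real \<Rightarrow> real" where
  "poisson_kernel z \<tau> = (1 - (cmod z)\<^sup>2) / (cmod (cis \<tau> - z))\<^sup>2"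

lemma cis_ne_ball: "cmod z < 1 \<Longrightarrow> cis \<tau> \<noteq> z"
  by (metis norm_cis less_irrefl)

lemma poisson_kernel_pos: "cmod z < 1 \<Longrightarrow> poisson_kernel z \<tau> > 0"
  using cis_ne_ball[of z \<tau>] by (auto simp: poisson_kernel_def power_less_one_iff abs_square_less_1)

lemma continuous_on_poisson_kernel [continuous_intros]:
  assumes "continuous_on A f" "continuous_on A g" "\<And>x. x \<in> A \<Longrightarrow> cmod (f x) < 1"
  shows "continuous_on A (\<lambda>x. poisson_kernel (f x) (g x))"
  unfolding poisson_kernel_def
  using assms cis_ne_ball by (intro continuous_intros) auto

text \<open>
  As the real part of a rational function the kernel is easy to integrate and to difference in \<open>z\<close>.
\<close>

lemma poisson_kernel_eq_Re:
  assumes "cmod z < 1"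
  shows "poisson_kernel z \<tau> = Re ((cis \<tau> + z) / (cis \<tau> - z))"
proof -
  have "Re ((cis \<tau> + z) * cnj (cis \<tau> - z)) = 1 - (cmod z)\<^sup>2"
    unfolding cmod_power2 using sin_cos_squared_add[of \<tau>]
    by (simp add: power2_eq_square algebra_simps)
  then show ?thesis
    unfolding poisson_kernel_def by (subst complex_div_cnj) (simp only: Re_divide_of_real of_real_power[symmetric])
qed

lemma poisson_kernel_diff_le:
  assumes "cmod z1 < 1" "cmod z2 < 1"
  shows "\<bar>poisson_kernel z1 \<tau> - poisson_kernel z2 \<tau>\<bar>
         \<le> 2 * cmod (z1 - z2) / (cmod (cis \<tau> - z1) * cmod (cis \<tau> - z2))"
proof -
  let ?c = "cis \<tau>"
  have ne: "?c - z1 \<noteq> 0" "?c - z2 \<noteq> 0"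
    using assms cis_ne_ball by auto
  have "\<bar>poisson_kernel z1 \<tau> - poisson_kernel z2 \<tau>\<bar> = \<bar>Re ((?c + z1) / (?c - z1) - (?c + z2) / (?c - z2))\<bar>"
    using assms by (simp add: poisson_kernel_eq_Re)
  also have "\<dots> \<le> cmod ((?c + z1) / (?c - z1) - (?c + z2) / (?c - z2))"
    by (rule abs_Re_le_cmod)
  also have "(?c + z1) / (?c - z1) - (?c + z2) / (?c - z2) = 2 * ?c * (z1 - z2) / ((?c - z1) * (?c - z2))"
    using ne by (simp add: divide_simps) (simp add: algebra_simps)
  finally show ?thesis
    by (simp add: norm_divide norm_mult)
qed

text \<open>
  Cauchy's formula for the constant \<open>1\<close> gives \<open>\<integral> e\<^sup>i\<^sup>\<tau> / (e\<^sup>i\<^sup>\<tau> - z) d\<tau> = 2\<pi>\<close>, and the kernel is the real part of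
  \<open>2 e\<^sup>i\<^sup>\<tau> / (e\<^sup>i\<^sup>\<tau> - z) - 1\<close>.
\<close>

lemma has_integral_poisson_kernel:
  assumes "cmod z < 1"
  shows "(poisson_kernel z has_integral 2 * pi) {0..2*pi}"
proof -
  have "((\<lambda>u. 1 / (u - z)) has_contour_integral (2 * of_real pi * \<i> * 1)) (circlepath 0 1)"
    using assms by (intro Cauchy_integral_circlepath) auto
  then have "((\<lambda>t. 1 / (cis t - z) * \<i> * cis t) has_integral 2 * of_real pi * \<i>) {0..2*pi}"
    unfolding circlepath_def by (subst (asm) has_contour_integral_part_circlepath_iff) auto
  then have "((\<lambda>t. (-2 * \<i>) * (1 / (cis t - z) * \<i> * cis t) - 1)
      has_integral (-2 * \<i>) * (2 * of_real pi * \<i>) - of_real (2 * pi)) {0..2*pi}"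
    using has_integral_const_real[of "1::complex" 0 "2 * pi"]
    by (intro has_integral_diff has_integral_mult_right) (auto simp: scaleR_conv_of_real)
  also have "(\<lambda>t. (-2 * \<i>) * (1 / (cis t - z) * \<i> * cis t) - 1) = (\<lambda>t. (cis t + z) / (cis t - z))"
    using cis_ne_ball[OF assms] by (intro ext) (simp add: divide_simps)
  also have "(-2 * \<i>) * (2 * of_real pi * \<i>) - of_real (2 * pi) = of_real (2 * pi)"
    by (simp add: algebra_simps)
  finally have "((\<lambda>t. Re ((cis t + z) / (cis t - z))) has_integral Re (of_real (2 * pi))) {0..2*pi}"
    by (rule has_integral_Re)
  then show ?thesis
    using has_integral_cong[of "{0..2*pi}" "poisson_kernel z", OF poisson_kernel_eq_Re[OF assms]] by simp
qed

lemma circle_integral_rotate: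
  fixes h :: "complex \<Rightarrow> 'b::euclidean_space"
  assumes h: "continuous_on (sphere 0 1) h" and "cmod \<xi> = 1"
  shows "integral {0..2*pi} (\<lambda>\<tau>. h (\<xi> * cis \<tau>)) = integral {0..2*pi} (\<lambda>\<tau>. h (cis \<tau>))"
proof -
  have \<xi>: "\<xi> = cis (Arg2pi \<xi>)"
    using Arg2pi_eq[of \<xi>] assms by (simp add: cis_conv_exp)
  have "continuous_on UNIV (\<lambda>\<tau>. h (cis \<tau>))"
    by (rule continuous_on_compose2[OF h]) (auto intro!: continuous_intros)
  then have "integral {0..2*pi} (\<lambda>\<tau>. h (cis (\<tau> + Arg2pi \<xi>))) = integral {0..2*pi} (\<lambda>\<tau>. h (cis \<tau>))"
    using Arg2pi_ge_0[of \<xi>] Arg2pi_lt_2pi[of \<xi>]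
    by (intro integral_periodic_shift) (auto simp flip: cis_mult)
  also have "(\<lambda>\<tau>. h (cis (\<tau> + Arg2pi \<xi>))) = (\<lambda>\<tau>. h (\<xi> * cis \<tau>))"
    by (subst (2) \<xi>) (simp add: cis_mult add.commute)
  finally show ?thesis .
qed

lemma continuous_on_circle:
  assumes "continuous_on (sphere 0 1) \<phi>" "continuous_on A f" "\<And>x. x \<in> A \<Longrightarrow> cmod (f x) = 1"
  shows "continuous_on A (\<lambda>x. \<phi> (f x))"
  by (rule continuous_on_compose2[OF assms(1,2)]) (use assms(3) in auto)

lemma poisson_ext_eq_integral:
  assumes "continuous_on (sphere 0 1) \<phi>" "cmod z < 1"
  shows "poisson_ext \<phi> z
         = 1 / (2 * of_real pi) * integral {0..2*pi} (\<lambda>\<tau>. \<phi> (cis \<tau>) * of_real (poisson_kernel z \<tau>))"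
proof -
  have "continuous_on {0..2*pi} (\<lambda>\<tau>. \<phi> (cis \<tau>) * of_real (poisson_kernel z \<tau>))"
    using assms by (intro continuous_intros continuous_on_circle[OF assms(1)]) auto
  from LINT_eq_HK[OF this] show ?thesis
    using assms(2) by (simp add: poisson_ext_def poisson_kernel_def)
qed

lemma poisson_ext_rotate:
  assumes \<phi>: "continuous_on (sphere 0 1) \<phi>" and z: "cmod z < 1" and \<xi>: "cmod \<xi> = 1"
  shows "poisson_ext \<phi> (\<xi> * z)
         = 1 / (2 * of_real pi) * integral {0..2*pi} (\<lambda>\<tau>. \<phi> (\<xi> * cis \<tau>) * of_real (poisson_kernel z \<tau>))"
proof -
  define h where "h \<zeta> = \<phi> \<zeta> * of_real ((1 - (cmod z)\<^sup>2) / (cmod (\<zeta> - \<xi> * z))\<^sup>2)" for \<zeta>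
  have nz: "\<zeta> \<noteq> \<xi> * z" if "cmod \<zeta> = 1" for \<zeta>
    using that z \<xi> by (auto simp: norm_mult)
  have h: "continuous_on (sphere 0 1) h"
    unfolding h_def by (intro continuous_intros \<phi>) (use nz in auto)
  have "cmod (\<xi> * cis \<tau> - \<xi> * z) = cmod (cis \<tau> - z)" for \<tau>
    using \<xi> by (simp add: norm_mult flip: right_diff_distrib)
  then have "(\<lambda>\<tau>. \<phi> (\<xi> * cis \<tau>) * of_real (poisson_kernel z \<tau>)) = (\<lambda>\<tau>. h (\<xi> * cis \<tau>))"
    by (simp add: h_def poisson_kernel_def)
  then have "integral {0..2*pi} (\<lambda>\<tau>. \<phi> (\<xi> * cis \<tau>) * of_real (poisson_kernel z \<tau>))
      = integral {0..2*pi} (\<lambda>\<tau>. h (cis \<tau>))"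
    using circle_integral_rotate[OF h \<xi>] by simp
  also have "(\<lambda>\<tau>. h (cis \<tau>)) = (\<lambda>\<tau>. \<phi> (cis \<tau>) * of_real (poisson_kernel (\<xi> * z) \<tau>))"
    using \<xi> by (simp add: h_def poisson_kernel_def norm_mult)
  finally show ?thesis
    using poisson_ext_eq_integral[OF \<phi>, of "\<xi> * z"] z \<xi> by (simp add: norm_mult)
qed

text \<open>
  Subtracting a constant costs nothing because the kernel has total mass \<open>2\<pi>\<close>; the cancellation
  in \<open>\<phi>(\<xi> e\<^sup>i\<^sup>\<tau>) - c\<close> near the peak of the kernel is what all estimates rest on.
\<close>

lemma poisson_ext_rotate_diff:
  assumes \<phi>: "continuous_on (sphere 0 1) \<phi>" and z: "cmod z < 1" and \<xi>: "cmod \<xi> = 1"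
  shows "poisson_ext \<phi> (\<xi> * z) - c
         = 1 / (2 * of_real pi) * integral {0..2*pi} (\<lambda>\<tau>. (\<phi> (\<xi> * cis \<tau>) - c) * of_real (poisson_kernel z \<tau>))"
proof -
  let ?f = "\<lambda>\<tau>. \<phi> (\<xi> * cis \<tau>) * of_real (poisson_kernel z \<tau>)"
  have "?f integrable_on {0..2*pi}"
    using z \<xi> by (intro integrable_continuous_interval continuous_intros continuous_on_circle[OF \<phi>])
      (auto simp: norm_mult)
  moreover have "((\<lambda>\<tau>. c * of_real (poisson_kernel z \<tau>)) has_integral c * of_real (2 * pi)) {0..2*pi}"
    by (intro has_integral_mult_right has_integral_of_real has_integral_poisson_kernel z)
  ultimately have "((\<lambda>\<tau>. ?f \<tau> - c * of_real (poisson_kernel z \<tau>)) has_integral integral {0..2*pi} ?f - c * of_real (2 * pi)) {0..2*pi}"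
    by (intro has_integral_diff integrable_integral)
  then have "integral {0..2*pi} (\<lambda>\<tau>. (\<phi> (\<xi> * cis \<tau>) - c) * of_real (poisson_kernel z \<tau>)) = integral {0..2*pi} ?f - c * of_real (2 * pi)"
    by (simp add: integral_unique left_diff_distrib)
  then show ?thesis
    by (simp add: poisson_ext_rotate[OF \<phi> z \<xi>] field_simps)
qed

lemma continuous_on_poisson_ext:
  assumes \<phi>: "continuous_on (sphere 0 1) \<phi>"
  shows "continuous_on (ball 0 1) (poisson_ext \<phi>)"
proof -
  have "continuous_on (ball 0 1 \<times> cbox 0 (2*pi)) (\<lambda>(z, \<tau>). \<phi> (cis \<tau>) * of_real (poisson_kernel z \<tau>))"
    unfolding case_prod_beta
    by (intro continuous_intros continuous_on_circle[OF \<phi>]) auto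
  from integral_continuous_on_param[OF this]
  have "continuous_on (ball 0 1) (\<lambda>z. 1 / (2 * of_real pi) * integral {0..2*pi} (\<lambda>\<tau>. \<phi> (cis \<tau>) * of_real (poisson_kernel z \<tau>)))"
    by (intro continuous_intros) auto
  then show ?thesis
    by (subst continuous_on_cong[OF refl poisson_ext_eq_integral[OF \<phi>]]) auto
qed

lemma continuous_on_poisson_ext_circle:
  assumes \<phi>: "continuous_on (sphere 0 1) \<phi>" and z: "cmod z \<le> 1"
  shows "continuous_on UNIV (\<lambda>\<eta>. poisson_ext \<phi> (cis \<eta> * z))"
proof (cases "cmod z < 1")
  case True
  then show ?thesis
    by (intro continuous_on_compose2[OF continuous_on_poisson_ext[OF \<phi>]] continuous_intros) (auto simp: norm_mult)
next
  case False
  with z have z1: "cmod z = 1" by simp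
  then have "(\<lambda>\<eta>. poisson_ext \<phi> (cis \<eta> * z)) = (\<lambda>\<eta>. \<phi> (cis \<eta> * z))"
    by (simp add: poisson_ext_def norm_mult)
  with z1 show ?thesis
    by (simp only:, intro continuous_on_circle[OF \<phi>] continuous_intros) (auto simp: norm_mult)
qed

text \<open>
  The open disc and the circle are Borel sets, and the extension is continuous on each of them, so the passage from
  one to the other does not enter.
\<close>

lemma poisson_ext_borel:
  assumes \<phi>: "continuous_on (sphere 0 1) \<phi>"
  shows "poisson_ext \<phi> \<in> borel_measurable (restrict_space borel (cball 0 1))"
proof -
  have "continuous_on (sphere 0 1) (poisson_ext \<phi>)"
    using \<phi> by (subst continuous_on_cong[OF refl, of _ _ \<phi>]) (auto simp: poisson_ext_def)
  then have "(\<lambda>z. indicator (ball 0 1) z *\<^sub>R poisson_ext \<phi> z + indicator (sphere 0 1) z *\<^sub>R poisson_ext \<phi> z)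
      \<in> borel_measurable borel"
    using continuous_on_poisson_ext[OF \<phi>]
    by (intro borel_measurable_add borel_measurable_continuous_on_indicator) auto
  also have "(\<lambda>z. indicator (ball 0 1) z *\<^sub>R poisson_ext \<phi> z + indicator (sphere 0 1) z *\<^sub>R poisson_ext \<phi> z)
      = (\<lambda>z. indicator (cball 0 1) z *\<^sub>R poisson_ext \<phi> z)"
    by (auto simp: fun_eq_iff indicator_def)
  finally show ?thesis
    by (subst borel_measurable_restrict_space_iff) auto
qed

section \<open>Majorants and their integral against the squared distance\<close>

lemma
  assumes "majorant \<omega>"
  shows majorant_nonneg: "0 \<le> t \<Longrightarrow> 0 \<le> \<omega> t"
    and majorant_0: "\<omega> 0 = 0"
    and majorant_mono: "0 \<le> s \<Longrightarrow> s \<le> t \<Longrightarrow> \<omega> s \<le> \<omega> t"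
    and majorant_cont: "continuous_on {0..} \<omega>"
    and majorant_antimono: "0 < s \<Longrightarrow> s \<le> t \<Longrightarrow> \<omega> t / t \<le> \<omega> s / s"
  using assms by (auto simp: majorant_def monotone_on_def)

lemma majorant_scale:
  assumes "majorant \<omega>" "0 \<le> t" "1 \<le> c"
  shows "\<omega> (c * t) \<le> c * \<omega> t"
proof (cases "t = 0")
  case False
  then have "\<omega> (c * t) / (c * t) \<le> \<omega> t / t"
    using assms by (intro majorant_antimono) auto
  then show ?thesis using False assms by (simp add: field_simps)
qed (use majorant_0[OF assms(1)] in auto)

lemma majorant_add:
  assumes "majorant \<omega>" "0 \<le> s" "0 \<le> t"
  shows "\<omega> (s + t) \<le> \<omega> s + \<omega> t"
proof (cases "s = 0 \<or> t = 0")
  case False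
  then have "\<omega> (s + t) / (s + t) \<le> \<omega> s / s" "\<omega> (s + t) / (s + t) \<le> \<omega> t / t"
    using assms by (auto intro: majorant_antimono)
  then have "s * (\<omega> (s + t) / (s + t)) \<le> \<omega> s" "t * (\<omega> (s + t) / (s + t)) \<le> \<omega> t"
    using False assms by (auto simp: field_simps)
  moreover have "\<omega> (s + t) = s * (\<omega> (s + t) / (s + t)) + t * (\<omega> (s + t) / (s + t))"
    using False assms by (simp add: add_divide_distrib[symmetric] distrib_right[symmetric])
  ultimately show ?thesis by linarith
qed (use majorant_0[OF assms(1)] in auto)

lemma continuous_on_majorant:
  assumes "majorant \<omega>" "continuous_on A f" "\<And>x. x \<in> A \<Longrightarrow> 0 \<le> f x"
  shows "continuous_on A (\<lambda>x. \<omega> (f x))"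
  by (rule continuous_on_compose2[OF majorant_cont[OF assms(1)] assms(2)]) (use assms(3) in auto)

lemma norm_cis_minus_1: "cmod (cis t - 1) = 2 * \<bar>sin (t / 2)\<bar>"
  using dist_exp_i_1[of t] by (simp add: cis_conv_exp)

lemma norm_cis_minus_1_le: "cmod (cis t - 1) \<le> \<bar>t\<bar>"
  using abs_sin_x_le_abs_x[of "t/2"] by (simp add: norm_cis_minus_1)

text \<open>
  Jordan's inequality \<open>sin x \<ge> 2 x / \<pi>\<close> on \<open>[0, \<pi>/2]\<close>, by concavity of the sine.
\<close>

lemma norm_cis_minus_1_ge:
  assumes "0 \<le> t" "t \<le> pi"
  shows "2 * t / pi \<le> cmod (cis t - 1)"
proof -
  have "convex_on {0..pi} (\<lambda>x. - sin x)"
  proof (rule f''_ge0_imp_convex)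
    show "((\<lambda>x. - sin x) has_real_derivative - cos x) (at x)" for x
      by (auto intro!: derivative_eq_intros)
    show "((\<lambda>x. - cos x) has_real_derivative sin x) (at x)" for x
      by (auto intro!: derivative_eq_intros)
  qed (auto intro: sin_ge_zero)
  then have "- sin ((1 - t / pi) *\<^sub>R 0 + (t / pi) *\<^sub>R (pi / 2)) \<le> (1 - t / pi) * (- sin 0) + (t / pi) * (- sin (pi / 2))"
    using assms by (intro convex_onD) (auto simp: field_simps)
  then have "t / pi \<le> sin (t / 2)" by simp
  then show ?thesis by (simp add: norm_cis_minus_1)
qed

text \<open>
  The central estimate.  Near \<open>\<tau> = 0\<close> the denominator is at least \<open>(1 - r)\<^sup>2\<close>; away from \<open>0\<close> it is at least
  \<open>(\<tau> / \<pi>)\<^sup>2\<close>, since \<open>1\<close> is at most twice as far from \<open>e\<^sup>i\<^sup>\<tau>\<close> as \<open>r\<close> is.  Splitting at \<open>\<tau> = 1 - r\<close>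
  makes the second part the integral of the hypothesis.
\<close>

lemma majorant_poisson_integral:
  assumes \<omega>: "majorant \<omega>" and r: "0 \<le> r" "r < 1"
    and M: "(1 - r) * integral {1 - r..pi} (\<lambda>t. \<omega> t / t\<^sup>2) \<le> M * \<omega> (1 - r)"
  shows "integral {0..2*pi} (\<lambda>t. \<omega> (cmod (cis t - 1)) / (cmod (cis t - of_real r))\<^sup>2)
         \<le> 2 * (1 + pi\<^sup>2 * M) * \<omega> (1 - r) / (1 - r)"
proof -
  define d where "d = 1 - r"
  have d: "0 < d" "d \<le> 1" "d \<le> pi"
    using r pi_gt3 by (auto simp: d_def)
  define f where "f t = \<omega> (cmod (cis t - 1)) / (cmod (cis t - of_real r))\<^sup>2" for t
  have ne: "cis t \<noteq> of_real r" for t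
    using cis_ne_ball[of "of_real r" t] r by auto
  have f: "continuous_on A f" for A
    unfolding f_def by (intro continuous_intros continuous_on_majorant[OF \<omega>]) (use ne in auto)
  have int: "f integrable_on {a..b}" for a b
    by (intro integrable_continuous_interval f)
  have ev: "f (- t) = f t" for t
  proof -
    have "cis (- t) - of_real x = cnj (cis t - of_real x)" for x
      by (simp add: cis_cnj)
    then have "cmod (cis (- t) - of_real x) = cmod (cis t - of_real x)" for x
      by (metis complex_mod_cnj)
    from this[of r] this[of 1] show ?thesis by (simp add: f_def)
  qed
  have ge_d: "d \<le> cmod (cis t - of_real r)" for t
    using norm_triangle_ineq2[of "cis t" "of_real r"] r by (simp add: d_def)
  have le1: "\<omega> (cmod (cis t - 1)) \<le> \<omega> t" if "0 \<le> t" for t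
    using norm_cis_minus_1_le[of t] that by (intro majorant_mono[OF \<omega>]) auto
  have part1: "integral {0..d} f \<le> \<omega> d / d"
  proof -
    have "integral {0..d} f \<le> integral {0..d} (\<lambda>t. \<omega> d / d\<^sup>2)"
    proof (intro integral_le int integrable_const_ivl)
      fix t assume t: "t \<in> {0..d}"
      show "f t \<le> \<omega> d / d\<^sup>2"
        unfolding f_def
        using t d le1[of t] majorant_mono[OF \<omega>, of t d] ge_d[of t]
        by (intro frac_le majorant_nonneg[OF \<omega>] power_mono) auto
    qed
    then show ?thesis using d by (simp add: power2_eq_square)
  qed
  have part2: "integral {d..pi} f \<le> pi\<^sup>2 * M * \<omega> d / d"
  proof -
    have c: "continuous_on {d..pi} (\<lambda>t. \<omega> t / t\<^sup>2)"
      using d by (intro continuous_intros continuous_on_majorant[OF \<omega>]) auto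
    have "integral {d..pi} f \<le> integral {d..pi} (\<lambda>t. pi\<^sup>2 * (\<omega> t / t\<^sup>2))"
    proof (intro integral_le int integrable_continuous_interval continuous_on_mult continuous_on_const c)
      fix t assume t: "t \<in> {d..pi}"
      have "2 * t / pi \<le> cmod (cis t - 1)"
        using t d by (intro norm_cis_minus_1_ge) auto
      also have "\<dots> \<le> cmod (cis t - of_real r) + d"
      proof -
        have "cmod (of_real r - 1) = \<bar>r - 1\<bar>"
          by (metis norm_of_real of_real_1 of_real_diff)
        then show ?thesis
          using norm_triangle_ineq[of "cis t - of_real r" "of_real r - 1"] r by (simp add: d_def)
      qed
      also have "\<dots> \<le> 2 * cmod (cis t - of_real r)"
        using ge_d[of t] by simp
      finally have *: "t / pi \<le> cmod (cis t - of_real r)" by simp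
      have "f t \<le> \<omega> t / (t / pi)\<^sup>2"
        unfolding f_def
        using t d le1[of t] * by (intro frac_le majorant_nonneg[OF \<omega>] power_mono) auto
      then show "f t \<le> pi\<^sup>2 * (\<omega> t / t\<^sup>2)"
        by (simp add: power_divide mult.commute)
    qed
    also have "\<dots> = pi\<^sup>2 * integral {d..pi} (\<lambda>t. \<omega> t / t\<^sup>2)"
      by (rule integral_mult_right)
    also have "\<dots> \<le> pi\<^sup>2 * (M * \<omega> d / d)"
      using M d by (intro mult_left_mono) (auto simp: d_def field_simps)
    finally show ?thesis by (simp add: mult.assoc)
  qed
  have "integral {0..2*pi} f = 2 * integral {0..pi} f"
    by (intro integral_even_periodic f ev) (auto simp: f_def simp flip: cis_mult)
  also have "integral {0..pi} f = integral {0..d} f + integral {d..pi} f"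
    using d by (intro Henstock_Kurzweil_Integration.integral_combine[symmetric] int) auto
  also have "2 * (integral {0..d} f + integral {d..pi} f) \<le> 2 * (\<omega> d / d + pi\<^sup>2 * M * \<omega> d / d)"
    using part1 part2 by simp
  also have "\<dots> = 2 * (1 + pi\<^sup>2 * M) * \<omega> d / d"
    using d by (simp add: field_simps)
  finally show ?thesis by (simp add: f_def d_def)
qed

section \<open>Mean estimates for the Poisson integral\<close>

text \<open>
  The common form of the radial and the interior estimate: a kernel dominated by \<open>c / |e\<^sup>i\<^sup>\<tau> - r \<xi>|\<^sup>2\<close>, integrated against
  the increments of \<open>\<phi>\<close> from \<open>\<xi>\<close>, has \<open>p\<close>-mean at most \<open>M c\<close> times the integral \<open>K(r)\<close>.  This is Minkowski's
  inequality, followed by a rotation that takes \<open>\<xi>\<close> to \<open>1\<close>.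
\<close>

lemma mean_le_kernel_integral:
  fixes p :: ennreal
  assumes p: "1 \<le> p" and \<omega>: "majorant \<omega>" and M: "0 \<le> M" and c: "0 < c" and K: "0 \<le> K"
    and \<phi>: "continuous_on (sphere 0 1) \<phi>"
    and L: "\<And>\<xi>1 \<xi>2. cmod \<xi>1 = 1 \<Longrightarrow> cmod \<xi>2 = 1 \<Longrightarrow>
              mean_le p (\<lambda>\<eta>. \<phi> (cis \<eta> * \<xi>1) - \<phi> (cis \<eta> * \<xi>2)) (M * \<omega> (cmod (\<xi>1 - \<xi>2)))"
    and r: "0 \<le> r" "r < 1" and \<xi>: "cmod \<xi> = 1"
    and J: "integral {0..2*pi} (\<lambda>t. \<omega> (cmod (cis t - 1)) / (cmod (cis t - of_real r))\<^sup>2) \<le> K"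
    and k: "continuous_on UNIV k" "\<And>\<tau>. \<bar>k \<tau>\<bar> \<le> c / (cmod (cis \<tau> - of_real r * \<xi>))\<^sup>2"
    and g: "\<And>\<eta>. g \<eta> = 1 / (2 * of_real pi) * integral {0..2*pi} (\<lambda>\<tau>. (\<phi> (cis \<eta> * cis \<tau>) - \<phi> (cis \<eta> * \<xi>)) * of_real (k \<tau>))"
  shows "mean_le p g (M * c * K)"
proof -
  define \<kappa> where "\<kappa> \<tau> = c / (cmod (cis \<tau> - of_real r * \<xi>))\<^sup>2" for \<tau>
  define w where "w \<tau> = M * \<omega> (cmod (cis \<tau> - \<xi>))" for \<tau>
  have ne: "\<zeta> \<noteq> of_real r * \<xi>" if "cmod \<zeta> = 1" for \<zeta>
    using that r \<xi> by (auto simp: norm_mult)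
  have c\<kappa>: "continuous_on A \<kappa>" for A
    unfolding \<kappa>_def by (intro continuous_intros) (use ne in auto)
  have \<kappa>0: "\<kappa> \<tau> > 0" for \<tau>
    unfolding \<kappa>_def using ne[of "cis \<tau>"] c by auto
  have cw: "continuous_on A w" for A
    unfolding w_def by (intro continuous_intros continuous_on_majorant[OF \<omega>]) auto
  have w0: "w \<tau> \<ge> 0" for \<tau>
    unfolding w_def using majorant_nonneg[OF \<omega>] M by auto
  have ck: "continuous_on A k" for A
    using k(1) continuous_on_subset by blast
  have cG: "continuous_on A (\<lambda>\<tau>. \<phi> (cis \<eta> * cis \<tau>) - \<phi> (cis \<eta> * \<xi>))" for A \<eta>
    by (intro continuous_intros continuous_on_circle[OF \<phi>]) (auto simp: norm_mult)
  have "mean_le p g (integral {0..2*pi} (\<lambda>\<tau>. \<kappa> \<tau> * w \<tau>))"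
  proof (rule mean_le_integral[OF p])
    show "continuous_on UNIV (\<lambda>(\<tau>, \<eta>). \<phi> (cis \<eta> * cis \<tau>) - \<phi> (cis \<eta> * \<xi>))"
      unfolding case_prod_beta
      by (intro continuous_intros continuous_on_circle[OF \<phi>]) (auto simp: norm_mult \<xi>)
    show "mean_le p (\<lambda>\<eta>. \<phi> (cis \<eta> * cis \<tau>) - \<phi> (cis \<eta> * \<xi>)) (w \<tau>)" for \<tau>
      unfolding w_def using \<xi> by (intro L) auto
    fix \<eta>
    have "cmod (g \<eta>) \<le> cmod (integral {0..2*pi} (\<lambda>\<tau>. (\<phi> (cis \<eta> * cis \<tau>) - \<phi> (cis \<eta> * \<xi>)) * of_real (k \<tau>)))"
    proof -
      have "cmod (1 / (2 * of_real pi)) \<le> 1"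
        using pi_gt3 by (simp add: norm_divide norm_mult)
      then show ?thesis
        unfolding g norm_mult by (intro mult_left_le_one_le) auto
    qed
    also have "\<dots> \<le> integral {0..2*pi} (\<lambda>\<tau>. \<kappa> \<tau> * cmod (\<phi> (cis \<eta> * cis \<tau>) - \<phi> (cis \<eta> * \<xi>)))"
    proof (rule integral_norm_bound_integral)
      fix \<tau>
      show "cmod ((\<phi> (cis \<eta> * cis \<tau>) - \<phi> (cis \<eta> * \<xi>)) * of_real (k \<tau>)) \<le> \<kappa> \<tau> * cmod (\<phi> (cis \<eta> * cis \<tau>) - \<phi> (cis \<eta> * \<xi>))"
        using mult_right_mono[OF k(2)[of \<tau>] norm_ge_zero[of "\<phi> (cis \<eta> * cis \<tau>) - \<phi> (cis \<eta> * \<xi>)"]]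
        by (simp add: norm_mult \<kappa>_def mult.commute)
    qed (auto intro!: integrable_continuous_interval continuous_on_mult continuous_on_norm continuous_on_of_real cG c\<kappa> ck)
    finally show "cmod (g \<eta>) \<le> integral {0..2*pi} (\<lambda>\<tau>. \<kappa> \<tau> * cmod (\<phi> (cis \<eta> * cis \<tau>) - \<phi> (cis \<eta> * \<xi>)))" .
  qed (use c\<kappa> \<kappa>0 cw w0 in auto)
  moreover have "integral {0..2*pi} (\<lambda>\<tau>. \<kappa> \<tau> * w \<tau>) \<le> M * c * K"
  proof -
    define h where "h \<zeta> = \<omega> (cmod (\<zeta> - \<xi>)) / (cmod (\<zeta> - of_real r * \<xi>))\<^sup>2" for \<zeta>
    have h: "continuous_on (sphere 0 1) h"
      unfolding h_def by (intro continuous_intros continuous_on_majorant[OF \<omega>]) (use ne in auto)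
    have "(\<lambda>\<tau>. \<kappa> \<tau> * w \<tau>) = (\<lambda>\<tau>. (M * c) * h (cis \<tau>))"
      by (simp add: \<kappa>_def w_def h_def fun_eq_iff)
    then have "integral {0..2*pi} (\<lambda>\<tau>. \<kappa> \<tau> * w \<tau>) = (M * c) * integral {0..2*pi} (\<lambda>\<tau>. h (cis \<tau>))"
      by simp
    also have "integral {0..2*pi} (\<lambda>\<tau>. h (cis \<tau>)) = integral {0..2*pi} (\<lambda>\<tau>. h (\<xi> * cis \<tau>))"
      by (rule circle_integral_rotate[OF h \<xi>, symmetric])
    also have "(\<lambda>\<tau>. h (\<xi> * cis \<tau>)) = (\<lambda>t. \<omega> (cmod (cis t - 1)) / (cmod (cis t - of_real r))\<^sup>2)"
    proof
      fix t
      have "\<xi> * cis t - \<xi> = \<xi> * (cis t - 1)" "\<xi> * cis t - of_real r * \<xi> = \<xi> * (cis t - of_real r)"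
        by (auto simp: algebra_simps)
      then show "h (\<xi> * cis t) = \<omega> (cmod (cis t - 1)) / (cmod (cis t - of_real r))\<^sup>2"
        unfolding h_def using \<xi> by (simp add: norm_mult)
    qed
    also have "(M * c) * integral {0..2*pi} (\<lambda>t. \<omega> (cmod (cis t - 1)) / (cmod (cis t - of_real r))\<^sup>2) \<le> (M * c) * K"
      using J M c by (intro mult_left_mono) auto
    finally show ?thesis .
  qed
  moreover have "0 \<le> integral {0..2*pi} (\<lambda>\<tau>. \<kappa> \<tau> * w \<tau>)"
    using \<kappa>0 w0 by (intro integral_nonneg integrable_continuous_interval continuous_on_mult c\<kappa> cw) (auto simp: less_imp_le)
  ultimately show ?thesis
    using p by (auto intro: mean_le_mono[where g = g])
qed

text \<open>
  Here the kernel is the Poisson kernel itself, and \<open>1 - r\<^sup>2 \<le> 2 (1 - r)\<close> gives \<open>c = 2 (1 - r)\<close>.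
\<close>

lemma mean_le_poisson_radial:
  fixes p :: ennreal
  assumes p: "1 \<le> p" and \<omega>: "majorant \<omega>" and M: "0 \<le> M" and B: "0 \<le> B"
    and \<phi>: "continuous_on (sphere 0 1) \<phi>"
    and L: "\<And>\<xi>1 \<xi>2. cmod \<xi>1 = 1 \<Longrightarrow> cmod \<xi>2 = 1 \<Longrightarrow>
              mean_le p (\<lambda>\<eta>. \<phi> (cis \<eta> * \<xi>1) - \<phi> (cis \<eta> * \<xi>2)) (M * \<omega> (cmod (\<xi>1 - \<xi>2)))"
    and r: "0 \<le> r" "r < 1" and \<xi>: "cmod \<xi> = 1"
    and J: "integral {0..2*pi} (\<lambda>t. \<omega> (cmod (cis t - 1)) / (cmod (cis t - of_real r))\<^sup>2) \<le> B * \<omega> (1 - r) / (1 - r)"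
  shows "mean_le p (\<lambda>\<eta>. poisson_ext \<phi> (cis \<eta> * (of_real r * \<xi>)) - \<phi> (cis \<eta> * \<xi>)) (2 * M * B * \<omega> (1 - r))"
proof -
  let ?z = "of_real r * \<xi>"
  have z: "cmod ?z < 1" "cmod ?z = r"
    using r \<xi> by (auto simp: norm_mult)
  have "mean_le p (\<lambda>\<eta>. poisson_ext \<phi> (cis \<eta> * ?z) - \<phi> (cis \<eta> * \<xi>)) (M * (2 * (1 - r)) * (B * \<omega> (1 - r) / (1 - r)))"
  proof (rule mean_le_kernel_integral[OF p \<omega> M _ _ \<phi> L r \<xi> J])
    show "continuous_on UNIV (poisson_kernel ?z)"
      using z by (intro continuous_intros) auto
    show "\<bar>poisson_kernel ?z \<tau>\<bar> \<le> 2 * (1 - r) / (cmod (cis \<tau> - ?z))\<^sup>2" for \<tau>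
    proof -
      have "1 - r\<^sup>2 = (1 - r) * (1 + r)"
        by (simp add: power2_eq_square algebra_simps)
      also have "\<dots> \<le> (1 - r) * 2"
        using r by (intro mult_left_mono) auto
      finally have "poisson_kernel ?z \<tau> \<le> 2 * (1 - r) / (cmod (cis \<tau> - ?z))\<^sup>2"
        unfolding poisson_kernel_def z(2) by (intro divide_right_mono) auto
      then show ?thesis using poisson_kernel_pos[OF z(1), of \<tau>] by simp
    qed
    show "poisson_ext \<phi> (cis \<eta> * ?z) - \<phi> (cis \<eta> * \<xi>) = 1 / (2 * of_real pi) *
        integral {0..2*pi} (\<lambda>\<tau>. (\<phi> (cis \<eta> * cis \<tau>) - \<phi> (cis \<eta> * \<xi>)) * of_real (poisson_kernel ?z \<tau>))" for \<eta>
      by (rule poisson_ext_rotate_diff[OF \<phi> z(1)]) simp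
    show "0 \<le> B * \<omega> (1 - r) / (1 - r)"
      using B r majorant_nonneg[OF \<omega>, of "1 - r"] by simp
  qed (use r in auto)
  also have "M * (2 * (1 - r)) * (B * \<omega> (1 - r) / (1 - r)) = 2 * M * B * \<omega> (1 - r)"
    using r by (simp add: field_simps)
  finally show ?thesis .
qed

text \<open>
  Here the kernel is a difference of Poisson kernels.  As \<open>z\<^sub>2\<close> is no farther from \<open>r \<xi>\<close> than half the distance of
  \<open>r \<xi>\<close> from the circle, \<open>|e\<^sup>i\<^sup>\<tau> - z\<^sub>2|\<close> is at least half of \<open>|e\<^sup>i\<^sup>\<tau> - r \<xi>|\<close>, which gives \<open>c = 4 \<delta>\<close>
  with \<open>\<delta> = |r \<xi> - z\<^sub>2|\<close>.  The resulting factor \<open>\<delta> \<omega>(1 - r) / (1 - r)\<close> is at most \<open>\<omega>(\<delta>)\<close>.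
\<close>

lemma mean_le_poisson_interior:
  fixes p :: ennreal
  assumes p: "1 \<le> p" and \<omega>: "majorant \<omega>" and M: "0 \<le> M" and B: "0 \<le> B"
    and \<phi>: "continuous_on (sphere 0 1) \<phi>"
    and L: "\<And>\<xi>1 \<xi>2. cmod \<xi>1 = 1 \<Longrightarrow> cmod \<xi>2 = 1 \<Longrightarrow>
              mean_le p (\<lambda>\<eta>. \<phi> (cis \<eta> * \<xi>1) - \<phi> (cis \<eta> * \<xi>2)) (M * \<omega> (cmod (\<xi>1 - \<xi>2)))"
    and r: "0 \<le> r" "r < 1" and \<xi>: "cmod \<xi> = 1"
    and J: "integral {0..2*pi} (\<lambda>t. \<omega> (cmod (cis t - 1)) / (cmod (cis t - of_real r))\<^sup>2) \<le> B * \<omega> (1 - r) / (1 - r)"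
    and z2: "of_real r * \<xi> \<noteq> z2" "2 * cmod (of_real r * \<xi> - z2) \<le> 1 - r"
  shows "mean_le p (\<lambda>\<eta>. poisson_ext \<phi> (cis \<eta> * (of_real r * \<xi>)) - poisson_ext \<phi> (cis \<eta> * z2))
           (4 * M * B * \<omega> (cmod (of_real r * \<xi> - z2)))"
proof -
  let ?z = "of_real r * \<xi>"
  define \<delta> where "\<delta> = cmod (?z - z2)"
  have \<delta>: "\<delta> > 0" "2 * \<delta> \<le> 1 - r"
    using z2 by (auto simp: \<delta>_def)
  have z: "cmod ?z < 1" "cmod ?z = r"
    using r \<xi> by (auto simp: norm_mult)
  have z2': "cmod z2 < 1"
    using norm_triangle_ineq2[of z2 ?z] \<delta> z r by (simp add: \<delta>_def norm_minus_commute)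
  have K0: "0 \<le> B * \<omega> (1 - r) / (1 - r)"
    using B r majorant_nonneg[OF \<omega>, of "1 - r"] by simp
  have "mean_le p (\<lambda>\<eta>. poisson_ext \<phi> (cis \<eta> * ?z) - poisson_ext \<phi> (cis \<eta> * z2)) (M * (4 * \<delta>) * (B * \<omega> (1 - r) / (1 - r)))"
  proof (rule mean_le_kernel_integral[OF p \<omega> M _ K0 \<phi> L r \<xi> J])
    show "continuous_on UNIV (\<lambda>\<tau>. poisson_kernel ?z \<tau> - poisson_kernel z2 \<tau>)"
      using z z2' by (intro continuous_intros) auto
    show "\<bar>poisson_kernel ?z \<tau> - poisson_kernel z2 \<tau>\<bar> \<le> 4 * \<delta> / (cmod (cis \<tau> - ?z))\<^sup>2" for \<tau>
    proof -
      have ge: "2 * \<delta> \<le> cmod (cis \<tau> - ?z)"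
        using norm_triangle_ineq2[of "cis \<tau>" ?z] z \<delta> by simp
      have half: "cmod (cis \<tau> - ?z) / 2 \<le> cmod (cis \<tau> - z2)"
        using norm_triangle_ineq[of "cis \<tau> - z2" "z2 - ?z"] ge by (simp add: \<delta>_def norm_minus_commute)
      have "\<bar>poisson_kernel ?z \<tau> - poisson_kernel z2 \<tau>\<bar> \<le> 2 * \<delta> / (cmod (cis \<tau> - ?z) * cmod (cis \<tau> - z2))"
        unfolding \<delta>_def by (rule poisson_kernel_diff_le[OF z(1) z2'])
      also have "\<dots> \<le> 2 * \<delta> / (cmod (cis \<tau> - ?z) * (cmod (cis \<tau> - ?z) / 2))"
        using half \<delta> ge by (intro divide_left_mono mult_left_mono mult_pos_pos) auto
      also have "\<dots> = 4 * \<delta> / (cmod (cis \<tau> - ?z))\<^sup>2"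
        by (simp add: power2_eq_square)
      finally show ?thesis .
    qed
    fix \<eta>
    let ?f = "\<lambda>\<tau>. \<phi> (cis \<eta> * cis \<tau>) - \<phi> (cis \<eta> * \<xi>)"
    have f: "(\<lambda>\<tau>. ?f \<tau> * of_real (poisson_kernel z \<tau>)) integrable_on {0..2*pi}" if "cmod z < 1" for z
      using that by (intro integrable_continuous_interval continuous_intros continuous_on_circle[OF \<phi>])
        (auto simp: norm_mult)
    have eq: "poisson_ext \<phi> (cis \<eta> * z) - \<phi> (cis \<eta> * \<xi>)
        = 1 / (2 * of_real pi) * integral {0..2*pi} (\<lambda>\<tau>. ?f \<tau> * of_real (poisson_kernel z \<tau>))" if "cmod z < 1" for z
      by (rule poisson_ext_rotate_diff[OF \<phi> that]) simp
    have "poisson_ext \<phi> (cis \<eta> * ?z) - poisson_ext \<phi> (cis \<eta> * z2)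
        = (poisson_ext \<phi> (cis \<eta> * ?z) - \<phi> (cis \<eta> * \<xi>)) - (poisson_ext \<phi> (cis \<eta> * z2) - \<phi> (cis \<eta> * \<xi>))"
      by simp
    also have "\<dots> = 1 / (2 * of_real pi) *
        (integral {0..2*pi} (\<lambda>\<tau>. ?f \<tau> * of_real (poisson_kernel ?z \<tau>)) - integral {0..2*pi} (\<lambda>\<tau>. ?f \<tau> * of_real (poisson_kernel z2 \<tau>)))"
      unfolding eq[OF z(1)] eq[OF z2'] by (simp only: right_diff_distrib)
    also have "integral {0..2*pi} (\<lambda>\<tau>. ?f \<tau> * of_real (poisson_kernel ?z \<tau>)) - integral {0..2*pi} (\<lambda>\<tau>. ?f \<tau> * of_real (poisson_kernel z2 \<tau>))
        = integral {0..2*pi} (\<lambda>\<tau>. ?f \<tau> * of_real (poisson_kernel ?z \<tau>) - ?f \<tau> * of_real (poisson_kernel z2 \<tau>))"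
      by (rule integral_diff[OF f[OF z(1)] f[OF z2'], symmetric])
    also have "(\<lambda>\<tau>. ?f \<tau> * of_real (poisson_kernel ?z \<tau>) - ?f \<tau> * of_real (poisson_kernel z2 \<tau>))
        = (\<lambda>\<tau>. ?f \<tau> * of_real (poisson_kernel ?z \<tau> - poisson_kernel z2 \<tau>))"
      by (simp add: right_diff_distrib)
    finally show "poisson_ext \<phi> (cis \<eta> * ?z) - poisson_ext \<phi> (cis \<eta> * z2) = 1 / (2 * of_real pi) *
        integral {0..2*pi} (\<lambda>\<tau>. ?f \<tau> * of_real (poisson_kernel ?z \<tau> - poisson_kernel z2 \<tau>))" .
  qed (use \<delta> in auto)
  moreover have "M * (4 * \<delta>) * (B * \<omega> (1 - r) / (1 - r)) \<le> 4 * M * B * \<omega> \<delta>"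
  proof -
    have "\<omega> (1 - r) / (1 - r) \<le> \<omega> \<delta> / \<delta>"
      using \<delta> by (intro majorant_antimono[OF \<omega>]) auto
    then have "(4 * M * B * \<delta>) * (\<omega> (1 - r) / (1 - r)) \<le> (4 * M * B * \<delta>) * (\<omega> \<delta> / \<delta>)"
      using M B \<delta> by (intro mult_left_mono) auto
    then show ?thesis using \<delta> by (simp add: mult_ac)
  qed
  moreover have "0 \<le> M * (4 * \<delta>) * (B * \<omega> (1 - r) / (1 - r))"
    using M \<delta> K0 by (intro mult_nonneg_nonneg) auto
  ultimately show ?thesis
    unfolding \<delta>_def[symmetric] using p by (auto intro: mean_le_mono)
qed

section \<open>From the integral condition to the Poisson integral\<close>

lemma integral_condition_imp_HK:
  assumes "majorant \<omega>" "integral_condition \<omega>"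
  obtains M where "M > 0" "\<And>\<delta>. 0 < \<delta> \<Longrightarrow> \<delta> \<le> pi \<Longrightarrow> \<delta> * integral {\<delta>..pi} (\<lambda>t. \<omega> t / t\<^sup>2) \<le> M * \<omega> \<delta>"
proof -
  obtain M where M: "M > 0" "\<And>\<delta>. \<delta> \<in> {0..pi} \<Longrightarrow> \<delta> * (LINT t|lebesgue_on {\<delta>..pi}. \<omega> t / t\<^sup>2) \<le> M * \<omega> \<delta>"
    using assms(2) unfolding integral_condition_def by blast
  have "\<delta> * integral {\<delta>..pi} (\<lambda>t. \<omega> t / t\<^sup>2) \<le> M * \<omega> \<delta>" if "0 < \<delta>" "\<delta> \<le> pi" for \<delta>
  proof -
    have "continuous_on {\<delta>..pi} (\<lambda>t. \<omega> t / t\<^sup>2)"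
      using that by (intro continuous_intros continuous_on_majorant[OF assms(1)]) auto
    from LINT_eq_HK[OF this] show ?thesis using M(2)[of \<delta>] that by simp
  qed
  with M(1) show thesis by (rule that)
qed

lemma polar_decomposition:
  obtains \<xi> where "cmod \<xi> = 1" "z = of_real (cmod z) * \<xi>"
proof (rule that)
  show "z = of_real (cmod z) * cis (Arg z)"
    using rcis_cmod_Arg[of z] by (simp add: rcis_def)
qed simp

text \<open>
  Points that are close together compared with the distance of \<open>z\<^sub>1\<close> from the circle fall under the interior
  estimate.  Otherwise the path through the radial projections \<open>\<xi>\<^sub>1\<close> and \<open>\<xi>\<^sub>2\<close> has three legs of length at most
  \<open>6 \<delta>\<close>, and a majorant grows at most by the factor by which its argument is stretched.
\<close>

lemma integral_condition_imp_poisson: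
  assumes \<omega>: "majorant \<omega>" and C: "integral_condition \<omega>" and p: "1 \<le> p"
  shows "poisson_preserves_Lambda \<omega> p"
  unfolding poisson_preserves_Lambda_def
proof (intro ballI impI)
  fix \<phi> assume mem: "\<phi> \<in> Lambda_circle \<omega> p" and \<phi>: "continuous_on (sphere 0 1) \<phi>"
  obtain M where M: "M > 0" and M': "\<And>\<xi>1 \<xi>2. cmod \<xi>1 = 1 \<Longrightarrow> cmod \<xi>2 = 1 \<Longrightarrow>
      Lp_diff p \<phi> \<xi>1 \<xi>2 \<le> ennreal (M * \<omega> (cmod (\<xi>1 - \<xi>2)))"
    using mem unfolding Lambda_circle_def by auto
  have L: "mean_le p (\<lambda>\<eta>. \<phi> (cis \<eta> * \<xi>1) - \<phi> (cis \<eta> * \<xi>2)) (M * \<omega> (cmod (\<xi>1 - \<xi>2)))"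
    if "cmod \<xi>1 = 1" "cmod \<xi>2 = 1" for \<xi>1 \<xi>2
    using M'[OF that] M majorant_nonneg[OF \<omega>] by (subst (asm) Lp_diff_le_iff[OF p]) auto
  obtain M0 where M0: "M0 > 0" "\<And>\<delta>. 0 < \<delta> \<Longrightarrow> \<delta> \<le> pi \<Longrightarrow> \<delta> * integral {\<delta>..pi} (\<lambda>t. \<omega> t / t\<^sup>2) \<le> M0 * \<omega> \<delta>"
    by (rule integral_condition_imp_HK[OF \<omega> C]) blast
  define B where "B = 2 * (1 + pi\<^sup>2 * M0)"
  have B: "B \<ge> 0" using M0 by (simp add: B_def)
  have J: "integral {0..2*pi} (\<lambda>t. \<omega> (cmod (cis t - 1)) / (cmod (cis t - of_real r))\<^sup>2) \<le> B * \<omega> (1 - r) / (1 - r)"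
    if "0 \<le> r" "r < 1" for r
    unfolding B_def using that pi_gt3 by (intro majorant_poisson_integral[OF \<omega>] M0(2)) auto
  let ?F = "poisson_ext \<phi>"
  have radial: "mean_le p (\<lambda>\<eta>. ?F (cis \<eta> * z) - \<phi> (cis \<eta> * \<xi>)) (2 * M * B * \<omega> (1 - cmod z))"
    if "cmod z \<le> 1" "cmod \<xi> = 1" "z = of_real (cmod z) * \<xi>" for z \<xi>
  proof (cases "cmod z < 1")
    case True
    have "mean_le p (\<lambda>\<eta>. ?F (cis \<eta> * (of_real (cmod z) * \<xi>)) - \<phi> (cis \<eta> * \<xi>)) (2 * M * B * \<omega> (1 - cmod z))"
      by (rule mean_le_poisson_radial[OF p \<omega> less_imp_le[OF M] B \<phi> L norm_ge_zero True that(2) J[OF norm_ge_zero True]])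
    then show ?thesis
      by (simp only: that(3)[symmetric])
  next
    case False
    with that have z: "cmod z = 1" "z = \<xi>" by auto
    then have "(\<lambda>\<eta>. ?F (cis \<eta> * z) - \<phi> (cis \<eta> * \<xi>)) = (\<lambda>\<eta>. 0)"
      by (simp add: poisson_ext_def norm_mult)
    then show ?thesis using z majorant_0[OF \<omega>] by (simp add: mean_le_def)
  qed
  \<comment> \<open>The three legs below are each bounded by \<open>c = 6 M (B + 1) \<omega> \<delta>\<close>; adding them up in two steps costs \<open>4\<^sup>2\<close>.\<close>
  define D where "D = 96 * M * (B + 1)"
  have D: "D > 0" using M B by (simp add: D_def)
  have "Lp_diff p ?F z1 z2 \<le> ennreal (D * \<omega> (cmod (z1 - z2)))"
    if z: "cmod z1 \<le> 1" "cmod z2 \<le> 1" for z1 z2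
  proof -
    define \<delta> where "\<delta> = cmod (z1 - z2)"
    have \<delta>0: "\<delta> \<ge> 0" by (simp add: \<delta>_def)
    have \<omega>\<delta>: "\<omega> \<delta> \<ge> 0" by (rule majorant_nonneg[OF \<omega> \<delta>0])
    obtain \<xi>1 where \<xi>1: "cmod \<xi>1 = 1" "z1 = of_real (cmod z1) * \<xi>1" by (rule polar_decomposition)
    obtain \<xi>2 where \<xi>2: "cmod \<xi>2 = 1" "z2 = of_real (cmod z2) * \<xi>2" by (rule polar_decomposition)
    have "mean_le p (\<lambda>\<eta>. ?F (cis \<eta> * z1) - ?F (cis \<eta> * z2)) (D * \<omega> \<delta>)"
    proof (cases "z1 = z2")
      case True
      then show ?thesis using D \<omega>\<delta> by (simp add: mean_le_def)
    next
      case ne: False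
      then have \<delta>: "\<delta> > 0" by (simp add: \<delta>_def)
      show ?thesis
      proof (cases "2 * \<delta> \<le> 1 - cmod z1")
        case True
        with \<delta> have r: "cmod z1 < 1" by simp
        have z1: "of_real (cmod z1) * \<xi>1 = z1"
          by (rule \<xi>1(2)[symmetric])
        have "mean_le p (\<lambda>\<eta>. ?F (cis \<eta> * (of_real (cmod z1) * \<xi>1)) - ?F (cis \<eta> * z2))
            (4 * M * B * \<omega> (cmod (of_real (cmod z1) * \<xi>1 - z2)))"
        proof (rule mean_le_poisson_interior[OF p \<omega> less_imp_le[OF M] B \<phi> L norm_ge_zero r \<xi>1(1) J[OF norm_ge_zero r]])
          show "of_real (cmod z1) * \<xi>1 \<noteq> z2"
            unfolding z1 by (rule ne)
          show "2 * cmod (of_real (cmod z1) * \<xi>1 - z2) \<le> 1 - cmod z1"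
            unfolding z1 using True by (simp only: \<delta>_def)
        qed
        then have "mean_le p (\<lambda>\<eta>. ?F (cis \<eta> * z1) - ?F (cis \<eta> * z2)) (4 * M * B * \<omega> \<delta>)"
          unfolding z1 \<delta>_def .
        moreover have "4 * M * B * \<omega> \<delta> \<le> D * \<omega> \<delta>"
          using M B \<omega>\<delta> by (intro mult_right_mono) (auto simp: D_def distrib_left)
        moreover have "0 \<le> 4 * M * B * \<omega> \<delta>"
          using M B \<omega>\<delta> by simp
        ultimately show ?thesis using p by (auto intro: mean_le_mono)
      next
        case False
        then have d1: "1 - cmod z1 \<le> 3 * \<delta>"
          using \<delta> by simp
        have d2: "1 - cmod z2 \<le> 3 * \<delta>"
          using False norm_triangle_ineq2[of z1 z2] by (simp add: \<delta>_def)
        define c where "c = 6 * M * (B + 1) * \<omega> \<delta>"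
        have c: "c \<ge> 0" using M B \<omega>\<delta> by (simp add: c_def)
        have rad: "mean_le p (\<lambda>\<eta>. ?F (cis \<eta> * z) - \<phi> (cis \<eta> * \<xi>)) c"
          if "cmod z \<le> 1" "cmod \<xi> = 1" "z = of_real (cmod z) * \<xi>" "1 - cmod z \<le> 3 * \<delta>" for z \<xi>
        proof (rule mean_le_mono[OF radial[OF that(1-3)]])
          have "\<omega> (1 - cmod z) \<le> \<omega> (3 * \<delta>)"
            using that by (intro majorant_mono[OF \<omega>]) auto
          also have "\<dots> \<le> 3 * \<omega> \<delta>"
            using \<delta>0 by (intro majorant_scale[OF \<omega>]) auto
          finally have "2 * M * B * \<omega> (1 - cmod z) \<le> 2 * M * B * (3 * \<omega> \<delta>)"
            using M B by (intro mult_left_mono) auto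
          also have "\<dots> \<le> c"
            using M \<omega>\<delta> by (simp add: c_def distrib_left distrib_right)
          finally show "2 * M * B * \<omega> (1 - cmod z) \<le> c" .
          show "0 \<le> 2 * M * B * \<omega> (1 - cmod z)"
            using M B that majorant_nonneg[OF \<omega>, of "1 - cmod z"] by simp
        qed (use p in auto)
        have mid: "mean_le p (\<lambda>\<eta>. \<phi> (cis \<eta> * \<xi>1) - \<phi> (cis \<eta> * \<xi>2)) c"
        proof (rule mean_le_mono[OF L[OF \<xi>1(1) \<xi>2(1)]])
          have dist: "cmod (z - \<xi>) = 1 - cmod z" if "cmod z \<le> 1" "cmod \<xi> = 1" "z = of_real (cmod z) * \<xi>" for z \<xi>
          proof -
            have "z - \<xi> = of_real (cmod z - 1) * \<xi>"
              by (subst that(3)) (simp add: algebra_simps)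
            then show ?thesis using that(1,2) by (simp add: norm_mult del: of_real_diff)
          qed
          have "cmod (\<xi>1 - \<xi>2) \<le> cmod (z1 - \<xi>1) + cmod (z1 - z2) + cmod (z2 - \<xi>2)"
            using norm_triangle_ineq4[of "z1 - z2 - (z1 - \<xi>1)" "\<xi>2 - z2"] norm_triangle_ineq4[of "z1 - z2" "z1 - \<xi>1"]
            by (simp add: norm_minus_commute)
          also have "\<dots> \<le> 6 * \<delta>"
            using dist[OF z(1) \<xi>1] dist[OF z(2) \<xi>2] d2 False by (simp add: \<delta>_def)
          finally have "cmod (\<xi>1 - \<xi>2) \<le> 6 * \<delta>" .
          then have "\<omega> (cmod (\<xi>1 - \<xi>2)) \<le> \<omega> (6 * \<delta>)"
            by (intro majorant_mono[OF \<omega>]) auto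
          also have "\<dots> \<le> 6 * \<omega> \<delta>"
            using \<delta>0 by (intro majorant_scale[OF \<omega>]) auto
          finally have "M * \<omega> (cmod (\<xi>1 - \<xi>2)) \<le> M * (6 * \<omega> \<delta>)"
            using M by (intro mult_left_mono) auto
          also have "\<dots> \<le> c"
            using M B \<omega>\<delta> by (simp add: c_def distrib_left distrib_right)
          finally show "M * \<omega> (cmod (\<xi>1 - \<xi>2)) \<le> c" .
        qed (use p M majorant_nonneg[OF \<omega>] in auto)
        have contF: "continuous_on UNIV (\<lambda>\<eta>. ?F (cis \<eta> * z))" if "cmod z \<le> 1" for z
          by (rule continuous_on_poisson_ext_circle[OF \<phi> that])
        have cont\<phi>: "continuous_on UNIV (\<lambda>\<eta>. \<phi> (cis \<eta> * \<xi>))" if "cmod \<xi> = 1" for \<xi>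
          using that by (intro continuous_intros continuous_on_circle[OF \<phi>]) (auto simp: norm_mult)
        note cont = continuous_on_diff[OF contF[OF z(1)] cont\<phi>[OF \<xi>1(1)]]
          continuous_on_diff[OF cont\<phi>[OF \<xi>1(1)] cont\<phi>[OF \<xi>2(1)]]
          continuous_on_diff[OF cont\<phi>[OF \<xi>2(1)] contF[OF z(2)]]
        have "mean_le p (\<lambda>\<eta>. \<phi> (cis \<eta> * \<xi>2) - ?F (cis \<eta> * z2)) c"
          using rad[OF z(2) \<xi>2 d2] by (subst mean_le_cong[OF norm_minus_commute])
        from mean_le_add[OF cont(2,3) mid this c p]
        have tail: "mean_le p (\<lambda>\<eta>. (\<phi> (cis \<eta> * \<xi>1) - \<phi> (cis \<eta> * \<xi>2)) + (\<phi> (cis \<eta> * \<xi>2) - ?F (cis \<eta> * z2))) (4 * c)" .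
        have head: "mean_le p (\<lambda>\<eta>. ?F (cis \<eta> * z1) - \<phi> (cis \<eta> * \<xi>1)) (4 * c)"
          by (rule mean_le_mono[OF rad[OF z(1) \<xi>1 d1]]) (use c p in auto)
        have "mean_le p (\<lambda>\<eta>. (?F (cis \<eta> * z1) - \<phi> (cis \<eta> * \<xi>1)) +
            ((\<phi> (cis \<eta> * \<xi>1) - \<phi> (cis \<eta> * \<xi>2)) + (\<phi> (cis \<eta> * \<xi>2) - ?F (cis \<eta> * z2)))) (4 * (4 * c))"
          using c by (intro mean_le_add[OF cont(1) continuous_on_add[OF cont(2,3)] head tail _ p]) simp
        then show ?thesis by (simp add: c_def D_def mult_ac)
      qed
    qed
    then show ?thesis
      using D \<omega>\<delta> p by (subst Lp_diff_le_iff) (auto simp: \<delta>_def)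
  qed
  then show "?F \<in> Lambda_disc \<omega> p"
    unfolding Lambda_disc_def using D poisson_ext_borel[OF \<phi>] by auto
qed

section \<open>From the Poisson integral to the integral condition\<close>

text \<open>
  The test function is \<open>\<omega>(|\<xi> - 1|)\<close>, evaluated at \<open>1\<close> and at \<open>r = 1 - \<delta>\<close>.  For \<open>\<delta> \<le> t \<le> \<pi>\<close> one has
  \<open>|e\<^sup>i\<^sup>t - r| \<le> 2 t\<close> and \<open>\<omega>(|e\<^sup>i\<^sup>t - 1|) \<ge> (2 / \<pi>) \<omega>(t)\<close>, so that the integrand of the Poisson
  integral dominates a multiple of \<open>\<delta> \<omega>(t) / t\<^sup>2\<close>.  For \<open>\<delta> > 1\<close> no radius corresponds to \<open>\<delta>\<close>, but there the
  condition holds for every majorant.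
\<close>

lemma poisson_imp_integral_condition:
  assumes \<omega>: "majorant \<omega>" and P: "poisson_preserves_Lambda \<omega> \<infinity>"
  shows "integral_condition \<omega>"
proof -
  define \<phi> :: "complex \<Rightarrow> complex" where "\<phi> \<xi> = of_real (\<omega> (cmod (\<xi> - 1)))" for \<xi>
  have c\<phi>: "continuous_on A \<phi>" for A
    unfolding \<phi>_def by (intro continuous_intros continuous_on_majorant[OF \<omega>]) auto
  have lip: "\<omega> (cmod (\<xi>1 - 1)) \<le> \<omega> (cmod (\<xi>1 - \<xi>2)) + \<omega> (cmod (\<xi>2 - 1))" for \<xi>1 \<xi>2
  proof -
    have "\<omega> (cmod (\<xi>1 - 1)) \<le> \<omega> (cmod (\<xi>1 - \<xi>2) + cmod (\<xi>2 - 1))"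
      using norm_triangle_ineq[of "\<xi>1 - \<xi>2" "\<xi>2 - 1"] by (intro majorant_mono[OF \<omega>]) auto
    then show ?thesis using majorant_add[OF \<omega>, of "cmod (\<xi>1 - \<xi>2)" "cmod (\<xi>2 - 1)"] by simp
  qed
  have "\<phi> \<in> Lambda_circle \<omega> \<infinity>"
  proof -
    have "(\<lambda>\<eta>. \<phi> (cis \<eta>)) \<in> borel_measurable (lebesgue_on {0..2*pi})"
      by (intro borel_measurable_lebesgue_on_continuous continuous_on_compose2[OF c\<phi>[of UNIV]] continuous_intros) auto
    moreover have "cmod (\<phi> (cis \<eta>)) \<le> \<omega> 2" for \<eta>
      using norm_triangle_ineq4[of "cis \<eta>" 1] majorant_nonneg[OF \<omega>, of "cmod (cis \<eta> - 1)"]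
        majorant_mono[OF \<omega>, of "cmod (cis \<eta> - 1)" 2] by (simp add: \<phi>_def)
    moreover have "cmod (\<phi> \<xi>1 - \<phi> \<xi>2) \<le> 1 * \<omega> (cmod (\<xi>1 - \<xi>2))" for \<xi>1 \<xi>2
    proof -
      have "cmod (\<phi> \<xi>1 - \<phi> \<xi>2) = \<bar>\<omega> (cmod (\<xi>1 - 1)) - \<omega> (cmod (\<xi>2 - 1))\<bar>"
        unfolding \<phi>_def by (metis norm_of_real of_real_diff)
      then show ?thesis using lip[of \<xi>1 \<xi>2] lip[of \<xi>2 \<xi>1] by (simp add: norm_minus_commute)
    qed
    ultimately have "\<phi> \<in> Lp_circle \<infinity>"
      and "\<forall>\<xi>1\<in>sphere 0 1. \<forall>\<xi>2\<in>sphere 0 1. Lp_diff \<infinity> \<phi> \<xi>1 \<xi>2 \<le> ennreal (1 * \<omega> (cmod (\<xi>1 - \<xi>2)))"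
      unfolding Lp_circle_def Lp_diff_def by (auto intro!: exI[of _ "\<omega> 2"] ennreal_leI)
    then show ?thesis
      unfolding Lambda_circle_def using zero_less_one by blast
  qed
  then have "poisson_ext \<phi> \<in> Lambda_disc \<omega> \<infinity>"
    using P c\<phi> unfolding poisson_preserves_Lambda_def by blast
  then obtain M where M: "M > 0" and "\<And>z1 z2. cmod z1 \<le> 1 \<Longrightarrow> cmod z2 \<le> 1 \<Longrightarrow>
      ennreal (cmod (poisson_ext \<phi> z1 - poisson_ext \<phi> z2)) \<le> ennreal (M * \<omega> (cmod (z1 - z2)))"
    unfolding Lambda_disc_def Lp_diff_def by auto
  then have M': "cmod (poisson_ext \<phi> z1 - poisson_ext \<phi> z2) \<le> M * \<omega> (cmod (z1 - z2))"
    if "cmod z1 \<le> 1" "cmod z2 \<le> 1" for z1 z2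
    using that majorant_nonneg[OF \<omega>] by (auto simp: ennreal_le_iff)
  have small: "\<delta> * integral {\<delta>..pi} (\<lambda>t. \<omega> t / t\<^sup>2) \<le> (4 * pi\<^sup>2 * M) * \<omega> \<delta>" if \<delta>: "0 < \<delta>" "\<delta> \<le> 1" for \<delta>
  proof -
    define r where "r = 1 - \<delta>"
    have r: "0 \<le> r" "r < 1" using \<delta> by (auto simp: r_def)
    then have r1: "cmod (of_real r) < 1" by simp
    define f where "f t = \<omega> (cmod (cis t - 1)) * poisson_kernel (of_real r) t" for t
    have cf: "continuous_on A f" for A
      unfolding f_def using r1 by (intro continuous_intros continuous_on_majorant[OF \<omega>]) auto
    have f0: "f t \<ge> 0" for t
      unfolding f_def using majorant_nonneg[OF \<omega>, of "cmod (cis t - 1)"] poisson_kernel_pos[OF r1, of t] by simp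
    have "poisson_ext \<phi> (of_real r) = 1 / (2 * of_real pi) * integral {0..2*pi} (\<lambda>\<tau>. of_real (f \<tau>))"
      using poisson_ext_eq_integral[OF c\<phi> r1] by (simp add: f_def \<phi>_def)
    also have "integral {0..2*pi} (\<lambda>\<tau>. complex_of_real (f \<tau>)) = of_real (integral {0..2*pi} f)"
      by (intro integral_unique has_integral_of_real integrable_integral integrable_continuous_interval cf)
    finally have "poisson_ext \<phi> (of_real r) = of_real (integral {0..2*pi} f / (2 * pi))"
      by simp
    moreover have "poisson_ext \<phi> 1 = 0"
      by (simp add: poisson_ext_def \<phi>_def majorant_0[OF \<omega>])
    moreover have "cmod (of_real r - 1) = \<delta>"
    proof -
      have "of_real r - 1 = complex_of_real (- \<delta>)" by (simp add: r_def)
      then show ?thesis using \<delta> by (simp only: norm_of_real abs_minus_cancel abs_of_pos)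
    qed
    moreover have "0 \<le> integral {0..2*pi} f"
      using f0 by (intro integral_nonneg integrable_continuous_interval cf) auto
    ultimately have up: "integral {0..2*pi} f / (2 * pi) \<le> M * \<omega> \<delta>"
      using M'[of "of_real r" 1] r by (simp del: of_real_divide add: norm_of_real)
    have c: "continuous_on {\<delta>..pi} (\<lambda>t. \<omega> t / t\<^sup>2)"
      using \<delta> by (intro continuous_intros continuous_on_majorant[OF \<omega>]) auto
    have "\<delta> / (2 * pi) * integral {\<delta>..pi} (\<lambda>t. \<omega> t / t\<^sup>2) = integral {\<delta>..pi} (\<lambda>t. \<delta> / (2 * pi) * (\<omega> t / t\<^sup>2))"
      by (rule integral_mult_right[symmetric])
    also have "\<dots> \<le> integral {\<delta>..pi} f"
    proof (intro integral_le integrable_continuous_interval cf continuous_on_mult continuous_on_const c)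
      fix t assume t: "t \<in> {\<delta>..pi}"
      then have t0: "t > 0" using \<delta> by simp
      have "\<omega> t = \<omega> (pi / 2 * (2 * t / pi))" by simp
      also have "\<dots> \<le> pi / 2 * \<omega> (2 * t / pi)"
        using t0 pi_gt3 by (intro majorant_scale[OF \<omega>]) auto
      also have "\<dots> \<le> pi / 2 * \<omega> (cmod (cis t - 1))"
        using t t0 norm_cis_minus_1_ge[of t] by (intro mult_left_mono majorant_mono[OF \<omega>]) auto
      finally have w: "2 / pi * \<omega> t \<le> \<omega> (cmod (cis t - 1))"
        by (simp add: field_simps)
      have "cmod (cis t - of_real r) \<le> cmod (cis t - 1) + cmod (1 - of_real r)"
        using norm_triangle_ineq[of "cis t - 1" "1 - of_real r"] by simp
      also have "\<dots> \<le> 2 * t"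
        using norm_cis_minus_1_le[of t] \<open>cmod (of_real r - 1) = \<delta>\<close> t t0 by (simp add: norm_minus_commute)
      finally have le: "cmod (cis t - of_real r) \<le> 2 * t" .
      have "\<delta> / (2 * t)\<^sup>2 \<le> (1 - r\<^sup>2) / (cmod (cis t - of_real r))\<^sup>2"
      proof (rule frac_le)
        show "\<delta> \<le> 1 - r\<^sup>2"
          using r \<delta> mult_nonneg_nonneg[of r \<delta>] by (simp add: r_def power2_eq_square algebra_simps)
        show "0 < (cmod (cis t - of_real r))\<^sup>2"
          using cis_ne_ball[OF r1, of t] by simp
        show "(cmod (cis t - of_real r))\<^sup>2 \<le> (2 * t)\<^sup>2"
          using le by (intro power_mono) auto
      qed (use r in \<open>auto simp: power_le_one_iff\<close>)
      then have pk: "\<delta> / (2 * t)\<^sup>2 \<le> poisson_kernel (of_real r) t"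
        using r by (simp add: poisson_kernel_def)
      have "\<delta> / (2 * pi) * (\<omega> t / t\<^sup>2) = (2 / pi * \<omega> t) * (\<delta> / (2 * t)\<^sup>2)"
        using t0 by (simp add: field_simps)
      also have "\<dots> \<le> f t"
        unfolding f_def using w pk \<delta> t0 majorant_nonneg[OF \<omega>] by (intro mult_mono) auto
      finally show "\<delta> / (2 * pi) * (\<omega> t / t\<^sup>2) \<le> f t" .
    qed
    also have "\<dots> \<le> integral {0..2*pi} f"
      using \<delta> f0 by (intro integral_subset_le integrable_continuous_interval cf) auto
    also have "\<dots> \<le> 2 * pi * (M * \<omega> \<delta>)"
      using up by (simp add: field_simps)
    finally have "2 * pi * (\<delta> / (2 * pi) * integral {\<delta>..pi} (\<lambda>t. \<omega> t / t\<^sup>2)) \<le> 2 * pi * (2 * pi * (M * \<omega> \<delta>))"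
      by (intro mult_left_mono) auto
    then show ?thesis by (simp add: power2_eq_square mult_ac)
  qed
  have large: "\<delta> * integral {\<delta>..pi} (\<lambda>t. \<omega> t / t\<^sup>2) \<le> pi * \<omega> \<delta>" if \<delta>: "1 \<le> \<delta>" "\<delta> \<le> pi" for \<delta>
  proof -
    have "integral {\<delta>..pi} (\<lambda>t. \<omega> t / t\<^sup>2) \<le> integral {\<delta>..pi} (\<lambda>t. \<omega> \<delta> / \<delta>)"
    proof (intro integral_le integrable_const_ivl integrable_continuous_interval continuous_intros continuous_on_majorant[OF \<omega>])
      fix t assume t: "t \<in> {\<delta>..pi}"
      have "\<omega> t / t\<^sup>2 \<le> \<omega> t / t"
        using t \<delta> majorant_nonneg[OF \<omega>, of t] by (intro divide_left_mono) (auto simp: power2_eq_square)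
      also have "\<dots> \<le> \<omega> \<delta> / \<delta>"
        using t \<delta> by (intro majorant_antimono[OF \<omega>]) auto
      finally show "\<omega> t / t\<^sup>2 \<le> \<omega> \<delta> / \<delta>" .
    qed (use \<delta> in auto)
    then have "\<delta> * integral {\<delta>..pi} (\<lambda>t. \<omega> t / t\<^sup>2) \<le> \<delta> * ((pi - \<delta>) * (\<omega> \<delta> / \<delta>))"
      using \<delta> by (intro mult_left_mono) auto
    also have "\<dots> = (pi - \<delta>) * \<omega> \<delta>"
      using \<delta> by simp
    also have "\<dots> \<le> pi * \<omega> \<delta>"
      using \<delta> majorant_nonneg[OF \<omega>, of \<delta>] by (intro mult_right_mono) auto
    finally show ?thesis .
  qed
  show ?thesis
    unfolding integral_condition_def
  proof (intro exI[of _ "4 * pi\<^sup>2 * M + pi"] conjI ballI)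
    show "4 * pi\<^sup>2 * M + pi > 0" using M by (simp add: add_pos_pos)
    fix \<delta> assume \<delta>: "\<delta> \<in> {0..pi}"
    show "\<delta> * (LINT t|lebesgue_on {\<delta>..pi}. \<omega> t / t\<^sup>2) \<le> (4 * pi\<^sup>2 * M + pi) * \<omega> \<delta>"
    proof (cases "\<delta> = 0")
      case True
      then show ?thesis by (simp add: majorant_0[OF \<omega>])
    next
      case False
      then have pos: "\<delta> > 0" using \<delta> by simp
      have "continuous_on {\<delta>..pi} (\<lambda>t. \<omega> t / t\<^sup>2)"
        using pos by (intro continuous_intros continuous_on_majorant[OF \<omega>]) auto
      then have "\<delta> * (LINT t|lebesgue_on {\<delta>..pi}. \<omega> t / t\<^sup>2) = \<delta> * integral {\<delta>..pi} (\<lambda>t. \<omega> t / t\<^sup>2)"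
        by (simp add: LINT_eq_HK)
      also have "\<dots> \<le> max (4 * pi\<^sup>2 * M * \<omega> \<delta>) (pi * \<omega> \<delta>)"
        using small[of \<delta>] large[of \<delta>] pos \<delta> by (cases "\<delta> \<le> 1") auto
      also have "\<dots> \<le> (4 * pi\<^sup>2 * M + pi) * \<omega> \<delta>"
        using M majorant_nonneg[OF \<omega>, of \<delta>] pos by (simp add: distrib_right)
      finally show ?thesis .
    qed
  qed
qed

theorem theorem2p5:
  fixes \<omega> :: "real \<Rightarrow> real"
  assumes "majorant \<omega>"
  shows "(\<forall>p::ennreal. 1 \<le> p \<longrightarrow> integral_condition \<omega> \<longrightarrow> poisson_preserves_Lambda \<omega> p) \<and>
         (poisson_preserves_Lambda \<omega> \<infinity> \<longleftrightarrow> integral_condition \<omega>)"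
  using integral_condition_imp_poisson[OF assms] poisson_imp_integral_condition[OF assms]
  by auto

end
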